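(* Let $\mathfrak g$ be a compact simple Lie algebra with $\dim\mathfrak g\ge 8$. Then: (1) $\mathfrak g\otimes\mathfrak g^\perp=W_{har}\oplus\bigoplus_i V_i$, where each $V_i$ is an irreducible $\mathfrak g$-module isomorphic to an irreducible submodule of $\Lambda^2\mathfrak g\oplus\Lambda^4\mathfrak g$; (2) $W_{har}^\perp(D_+)$ contains a $\mathfrak g$-submodule isomorphic to $\mathfrak g^\perp$; (3) $W_{har}^\perp(D_-)$ contains a $\mathfrak g$-submodule isomorphic to $\Lambda^3_\delta(\mathfrak g)$; (4) the image of $D_+$ contains $\omega_{\mathfrak g}\wedge\Lambda^1(\mathfrak g)$; (5) $D_-:\mathfrak g\otimes\mathfrak g^\perp\to\Lambda^2\mathfrak g$ is surjective.
   Context: Standing conventions: $\mathfrak g$ compact simple real Lie algebra, $B$ its Killing form, $\langle\cdot,\cdot\rangle:=-B$ extended to $\Lambda^k\mathfrak g$, $\mathfrak g\cong\mathfrak g^*$ via $\langle,\rangle$; $\omega_{\mathfrak g}(X,Y,Z)=B(X,[Y,Z])$; $\mathfrak g^\perp:=\ker(\Lambda^2\mathfrak g\to\mathfrak g,\ v\wedge w\mapsto[v,w])$; $\mathfrak{so}(\mathfrak g)\cong\Lambda^2\mathfrak g$ via $v\wedge w\mapsto(x\mapsto\langle v,x\rangle w-\langle w,x\rangle v)$, and $\rho_*$ the induced derivation action on $\Lambda^k\mathfrak g$. $D_+:\mathfrak g\otimes\mathfrak g^\perp\to\Lambda^4\mathfrak g$, $v\otimes\tau\mapsto v\wedge\rho_*(\tau)(\omega_{\mathfrak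 g})$; $D_-:\mathfrak g\otimes\mathfrak g^\perp\to\Lambda^2\mathfrak g$, $v\otimes\tau\mapsto v\lrcorner\rho_*(\tau)(\omega_{\mathfrak g})$. $W_{har}:=\ker D_+\cap\ker D_-$, and $W_{har}^\perp(D_\pm)$ is the orthogonal complement of $W_{har}$ in $\ker D_\pm$. The differential $d_{\mathfrak g}:\Lambda^k\mathfrak g\to\Lambda^{k+1}\mathfrak g$ is defined on $\Lambda^1$ by $\langle d_{\mathfrak g}v,x\wedge y\rangle=\langle v,[x,y]\rangle$ and extended by $d_{\mathfrak g}(\alpha\wedge\phi)=d_{\mathfrak g}\alpha\wedge\phi+(-1)^{\deg\alpha}\alpha\wedge d_{\mathfrak g}\phi$; $\delta_{\mathfrak g}$ is its adjoint; $\Lambda^3_\delta(\mathfrak g):=\delta_{\mathfrak g}(\Lambda^4\mathfrak g)$. *)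

theory Defs
  imports "HOL-Analysis.Analysis"
begin

text \<open>
  The Lie algebra g is a finite-dimensional real vector space (type 'g :: euclidean_space)
  with a bracket br.  Via the identification g = g* given by the inner product
  <,> = -B, elements of the exterior powers Lambda^k g (and of g (x) Lambda^2 g) are
  represented as k-linear forms on g, encoded as functions on lists of vectors
  ('g list => real) which vanish on lists of the wrong length.
\<close>

type_synonym 'g form = "'g list \<Rightarrow> real"

definition lie_algebra :: "('g::euclidean_space \<Rightarrow> 'g \<Rightarrow> 'g) \<Rightarrow> bool" where
  "lie_algebra br \<longleftrightarrow> bilinear br \<and> (\<forall>x. br x x = 0) \<and>
     (\<forall>x y z. br x (br y z) + br y (br z x) + br z (br x y) = 0)"

definition lie_ideal :: "('g::euclidean_space \<Rightarrow> 'g \<Rightarrow> 'g) \<Rightarrow> 'g set \<Rightarrow> bool" where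
  "lie_ideal br I \<longleftrightarrow> subspace I \<and> (\<forall>x y. y \<in> I \<longrightarrow> br x y \<in> I)"

definition simple_lie_algebra :: "('g::euclidean_space \<Rightarrow> 'g \<Rightarrow> 'g) \<Rightarrow> bool" where
  "simple_lie_algebra br \<longleftrightarrow> lie_algebra br \<and> (\<exists>x y. br x y \<noteq> 0) \<and>
     (\<forall>I. lie_ideal br I \<longrightarrow> I = {0} \<or> I = UNIV)"

definition compact_lie_algebra :: "('g::euclidean_space \<Rightarrow> 'g \<Rightarrow> 'g) \<Rightarrow> bool" where
  "compact_lie_algebra br \<longleftrightarrow> lie_algebra br \<and>
     (\<exists>Q :: 'g \<Rightarrow> 'g \<Rightarrow> real. bilinear Q \<and> (\<forall>x y. Q x y = Q y x) \<and>
        (\<forall>x. x \<noteq> 0 \<longrightarrow> Q x x > 0) \<and>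
        (\<forall>x y z. Q (br x y) z + Q y (br x z) = 0))"

definition trace_op :: "('g::euclidean_space \<Rightarrow> 'g) \<Rightarrow> real" where
  "trace_op f = (\<Sum>b\<in>Basis. f b \<bullet> b)"

definition killing :: "('g::euclidean_space \<Rightarrow> 'g \<Rightarrow> 'g) \<Rightarrow> 'g \<Rightarrow> 'g \<Rightarrow> real" where
  "killing br x y = trace_op (\<lambda>z. br x (br y z))"

definition kip :: "('g::euclidean_space \<Rightarrow> 'g \<Rightarrow> 'g) \<Rightarrow> 'g \<Rightarrow> 'g \<Rightarrow> real" where
  "kip br x y = - killing br x y"

text \<open>An orthonormal basis of g with respect to <,> = -B (used only to write
  basis-independent contractions).\<close>
definition is_onb :: "('g::euclidean_space \<Rightarrow> 'g \<Rightarrow> 'g) \<Rightarrow> 'g set \<Rightarrow> bool" where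
  "is_onb br E \<longleftrightarrow> finite E \<and> card E = DIM('g) \<and>
     (\<forall>a\<in>E. \<forall>b\<in>E. kip br a b = (if a = b then 1 else 0))"

definition onb :: "('g::euclidean_space \<Rightarrow> 'g \<Rightarrow> 'g) \<Rightarrow> 'g set" where
  "onb br = (SOME E. is_onb br E)"

definition zero_form :: "'g form" where "zero_form = (\<lambda>_. 0)"
definition fadd :: "'g form \<Rightarrow> 'g form \<Rightarrow> 'g form" where "fadd \<phi> \<psi> = (\<lambda>xs. \<phi> xs + \<psi> xs)"
definition fscale :: "real \<Rightarrow> 'g form \<Rightarrow> 'g form" where "fscale c \<phi> = (\<lambda>xs. c * \<phi> xs)"

definition multilinear_form :: "nat \<Rightarrow> ('g::euclidean_space) form \<Rightarrow> bool" where
  "multilinear_form k \<phi> \<longleftrightarrow> (\<forall>xs. length xs \<noteq> k \<longrightarrow> \<phi> xs = 0) \<and>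
     (\<forall>xs i. i < length xs \<longrightarrow> linear (\<lambda>v. \<phi> (xs[i := v])))"

definition Lam :: "nat \<Rightarrow> ('g::euclidean_space) form set" where
  "Lam k = {\<phi>. multilinear_form k \<phi> \<and>
     (\<forall>xs i j. i < j \<and> j < length xs \<and> xs ! i = xs ! j \<longrightarrow> \<phi> xs = 0)}"

definition del_nth :: "nat \<Rightarrow> 'a list \<Rightarrow> 'a list" where
  "del_nth i xs = take i xs @ drop (Suc i) xs"

definition flat :: "('g::euclidean_space \<Rightarrow> 'g \<Rightarrow> 'g) \<Rightarrow> 'g \<Rightarrow> 'g form" where
  "flat br v = (\<lambda>xs. case xs of [x] \<Rightarrow> kip br v x | _ \<Rightarrow> 0)"

definition omega :: "('g::euclidean_space \<Rightarrow> 'g \<Rightarrow> 'g) \<Rightarrow> 'g form" where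
  "omega br = (\<lambda>xs. case xs of [x, y, z] \<Rightarrow> killing br x (br y z) | _ \<Rightarrow> 0)"

text \<open>alpha wedge phi for a 1-form alpha (determinant convention).\<close>
definition wedge_l :: "'g form \<Rightarrow> 'g form \<Rightarrow> 'g form" where
  "wedge_l \<alpha> \<phi> = (\<lambda>xs. \<Sum>i<length xs. (-1) ^ i * \<alpha> [xs ! i] * \<phi> (del_nth i xs))"

definition wedge_r :: "'g form \<Rightarrow> 'g form \<Rightarrow> 'g form" where
  "wedge_r \<phi> \<alpha> = (\<lambda>xs. \<Sum>i<length xs. (-1) ^ (length xs - 1 - i) * \<alpha> [xs ! i] * \<phi> (del_nth i xs))"

definition interior :: "'g \<Rightarrow> 'g form \<Rightarrow> 'g form" where
  "interior v \<phi> = (\<lambda>xs. \<phi> (v # xs))"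

text \<open>The skew endomorphism of g corresponding to a 2-form tau under so(g) = Lambda^2 g:
  <A_tau x, y> = tau(x,y).\<close>
definition so_of :: "('g::euclidean_space \<Rightarrow> 'g \<Rightarrow> 'g) \<Rightarrow> 'g form \<Rightarrow> 'g \<Rightarrow> 'g" where
  "so_of br \<tau> x = (\<Sum>b\<in>onb br. \<tau> [x, b] *\<^sub>R b)"

text \<open>Derivation action of an endomorphism A on forms (transported from the action on
  multivectors via the identification g = g*, A skew).\<close>
definition der_act :: "('g \<Rightarrow> 'g) \<Rightarrow> 'g form \<Rightarrow> 'g form" where
  "der_act A \<phi> = (\<lambda>xs. - (\<Sum>i<length xs. \<phi> (xs[i := A (xs ! i)])))"

definition rho :: "('g::euclidean_space \<Rightarrow> 'g \<Rightarrow> 'g) \<Rightarrow> 'g form \<Rightarrow> 'g form \<Rightarrow> 'g form" where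
  "rho br \<tau> = der_act (so_of br \<tau>)"

definition gact :: "('g::euclidean_space \<Rightarrow> 'g \<Rightarrow> 'g) \<Rightarrow> 'g \<Rightarrow> 'g form \<Rightarrow> 'g form" where
  "gact br X = der_act (br X)"

text \<open>Induced inner product on forms of degree k (up to the positive factor k!).\<close>
definition ipf :: "('g::euclidean_space \<Rightarrow> 'g \<Rightarrow> 'g) \<Rightarrow> nat \<Rightarrow> 'g form \<Rightarrow> 'g form \<Rightarrow> real" where
  "ipf br k \<phi> \<psi> = (\<Sum>xs\<in>{xs. set xs \<subseteq> onb br \<and> length xs = k}. \<phi> xs * \<psi> xs)"

text \<open>g^perp = kernel of Lambda^2 g -> g, v wedge w |-> [v,w].\<close>
definition gperp :: "('g::euclidean_space \<Rightarrow> 'g \<Rightarrow> 'g) \<Rightarrow> 'g form set" where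
  "gperp br = {\<tau> \<in> Lam 2. (\<Sum>a\<in>onb br. \<Sum>b\<in>onb br. \<tau> [a, b] *\<^sub>R br a b) = 0}"

text \<open>g (x) g^perp, as trilinear forms T(x,y,z) with T(x,.,.) in g^perp for all x
  (v (x) tau corresponds to T(x,y,z) = <v,x> tau(y,z)).\<close>
definition TT :: "('g::euclidean_space \<Rightarrow> 'g \<Rightarrow> 'g) \<Rightarrow> 'g form set" where
  "TT br = {T. multilinear_form 3 T \<and> (\<forall>x. (\<lambda>ys. T (x # ys)) \<in> gperp br)}"

text \<open>D_+ and D_-, extended linearly: T = sum_a e_a (x) T(e_a,.,.).\<close>
definition D_plus :: "('g::euclidean_space \<Rightarrow> 'g \<Rightarrow> 'g) \<Rightarrow> 'g form \<Rightarrow> 'g form" where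
  "D_plus br T = (\<lambda>xs. \<Sum>a\<in>onb br.
      wedge_l (flat br a) (rho br (\<lambda>ys. T (a # ys)) (omega br)) xs)"

definition D_minus :: "('g::euclidean_space \<Rightarrow> 'g \<Rightarrow> 'g) \<Rightarrow> 'g form \<Rightarrow> 'g form" where
  "D_minus br T = (\<lambda>xs. \<Sum>a\<in>onb br.
      interior a (rho br (\<lambda>ys. T (a # ys)) (omega br)) xs)"

definition W_har :: "('g::euclidean_space \<Rightarrow> 'g \<Rightarrow> 'g) \<Rightarrow> 'g form set" where
  "W_har br = {T \<in> TT br. D_plus br T = zero_form \<and> D_minus br T = zero_form}"

definition ker_on :: "'g form set \<Rightarrow> ('g form \<Rightarrow> 'g form) \<Rightarrow> 'g form set" where
  "ker_on S D = {T \<in> S. D T = zero_form}"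

definition W_har_perp :: "('g::euclidean_space \<Rightarrow> 'g \<Rightarrow> 'g) \<Rightarrow> ('g form \<Rightarrow> 'g form) \<Rightarrow> 'g form set" where
  "W_har_perp br D = {T \<in> ker_on (TT br) D. \<forall>W\<in>W_har br. ipf br 3 T W = 0}"

text \<open>The Lie algebra differential d_g (formula of the unique antiderivation with
  (d v)(x,y) = <v,[x,y]>).\<close>
definition dform :: "('g::euclidean_space \<Rightarrow> 'g \<Rightarrow> 'g) \<Rightarrow> 'g form \<Rightarrow> 'g form" where
  "dform br \<phi> = (\<lambda>xs. \<Sum>i<length xs. \<Sum>j<length xs.
      if i < j then (-1) ^ (i + j + 1) * \<phi> (br (xs ! i) (xs ! j) # del_nth i (del_nth j xs))
      else 0)"

text \<open>Lambda^3_delta = delta(Lambda^4), delta the adjoint of d (ipf-normalisations only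
  rescale delta by a positive constant).\<close>
definition Lam3_delta :: "('g::euclidean_space \<Rightarrow> 'g \<Rightarrow> 'g) \<Rightarrow> 'g form set" where
  "Lam3_delta br = {\<psi> \<in> Lam 3. \<exists>\<phi>\<in>Lam 4.
      \<forall>\<xi>\<in>Lam 3. ipf br 3 \<psi> \<xi> = ipf br 4 \<phi> (dform br \<xi>)}"

definition Lam2_plus_Lam4 :: "('g::euclidean_space) form set" where
  "Lam2_plus_Lam4 = {fadd \<phi> \<psi> | \<phi> \<psi>. \<phi> \<in> Lam 2 \<and> \<psi> \<in> Lam 4}"

definition fsubspace :: "'g form set \<Rightarrow> bool" where
  "fsubspace U \<longleftrightarrow> zero_form \<in> U \<and> (\<forall>x\<in>U. \<forall>y\<in>U. fadd x y \<in> U) \<and>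
     (\<forall>c. \<forall>x\<in>U. fscale c x \<in> U)"

definition submodule :: "('g::euclidean_space \<Rightarrow> 'g \<Rightarrow> 'g) \<Rightarrow> 'g form set \<Rightarrow> 'g form set \<Rightarrow> bool" where
  "submodule br M U \<longleftrightarrow> fsubspace U \<and> U \<subseteq> M \<and> (\<forall>X. \<forall>u\<in>U. gact br X u \<in> U)"

definition irreducible_module :: "('g::euclidean_space \<Rightarrow> 'g \<Rightarrow> 'g) \<Rightarrow> 'g form set \<Rightarrow> bool" where
  "irreducible_module br U \<longleftrightarrow> submodule br U U \<and> U \<noteq> {zero_form} \<and>
     (\<forall>W. submodule br U W \<longrightarrow> W = {zero_form} \<or> W = U)"

definition module_iso :: "('g::euclidean_space \<Rightarrow> 'g \<Rightarrow> 'g) \<Rightarrow> 'g form set \<Rightarrow> 'g form set \<Rightarrow> bool" where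
  "module_iso br U V \<longleftrightarrow> (\<exists>f. (\<forall>x\<in>U. \<forall>y\<in>U. f (fadd x y) = fadd (f x) (f y)) \<and>
     (\<forall>c. \<forall>x\<in>U. f (fscale c x) = fscale c (f x)) \<and> bij_betw f U V \<and>
     (\<forall>X. \<forall>u\<in>U. f (gact br X u) = gact br X (f u)))"

end

theory Submission
  imports Defs "HOL-Library.Function_Algebras"
begin

text \<open>
  Write \<open>d\<close> for the differential, \<open>L\<^sub>x\<close> for the action of \<open>x\<close> and \<open>e\<^sub>a\<close> for an orthonormal
  basis. Since \<open>\<rho>\<^sub>*(\<tau>)(\<omega>) = - d\<tau>\<close>, both \<open>D\<^sub>+(T)\<close> and \<open>D\<^sub>-(T)\<close> are contractions of the
  differentials of the slices \<open>T(x,-,-)\<close>; in particular exact slices contribute nothing.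
  The inner product is invariant, so the complement of \<open>W\<^sub>h\<^sub>a\<^sub>r\<close> splits into irreducibles, on which
  \<open>(D\<^sub>-, D\<^sub>+)\<close> is injective. The other claims follow from explicit equivariant families,
  projected to the complement of \<open>W\<^sub>h\<^sub>a\<^sub>r\<close>:

  \<^item> \<open>\<Sum> e\<^sub>a \<otimes> L\<^sub>a\<sigma>\<close> with \<open>\<sigma> \<in> g\<^sup>\<bottom>\<close> is killed by \<open>D\<^sub>+\<close>, and \<open>D\<^sub>-\<close> maps it to the Casimir operator
    applied to \<open>\<sigma>\<close>, which is definite because there are no invariant 2-forms;
  \<^item> the projection of \<open>\<psi> \<in> \<Lambda>\<^sup>3\<^sub>\<delta>\<close> to \<open>g \<otimes> g\<^sup>\<bottom>\<close> changes slices by exact forms only, so it is mapped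
    to \<open>2 d\<psi>\<close> by \<open>D\<^sub>+\<close> and to a multiple of \<open>\<delta>\<psi> = 0\<close> by \<open>D\<^sub>-\<close>;
  \<^item> the projection of \<open>\<Sum> e\<^sub>a \<otimes> (v \<and> e\<^sub>a)\<close> is mapped to a multiple of \<open>\<omega> \<and> v\<close> by \<open>D\<^sub>+\<close> and to
    \<open>(3 - dim g) dv\<close> by \<open>D\<^sub>-\<close>.

  A 2-form orthogonal to the image of \<open>D\<^sub>-\<close> is then orthogonal to every \<open>dv\<close>, hence lies in \<open>g\<^sup>\<bottom>\<close>,
  and is orthogonal to its own image under the Casimir operator, hence vanishes.
\<close>

subsection \<open>The Killing form of a compact simple Lie algebra\<close>

definition orthonormal_for :: "('g::euclidean_space \<Rightarrow> 'g \<Rightarrow> real) \<Rightarrow> 'g set \<Rightarrow> bool" where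
  "orthonormal_for Q E \<longleftrightarrow> finite E \<and> (\<forall>a\<in>E. \<forall>b\<in>E. Q a b = (if a = b then 1 else 0))"

text \<open>The form is kept general because two instances occur: an invariant form \<open>Q\<close>
  supplied by compactness, through which the Killing form is shown to be negative definite, and then
  \<open>kip br\<close> itself.\<close>

locale pos_def_form =
  fixes Q :: "'g::euclidean_space \<Rightarrow> 'g \<Rightarrow> real"
  assumes bilin: "bilinear Q"
    and sym: "Q x y = Q y x"
    and pos: "x \<noteq> 0 \<Longrightarrow> Q x x > 0"
begin

lemma lin_l: "linear (\<lambda>x. Q x y)" and lin_r: "linear (\<lambda>y. Q x y)"
  using bilin by (auto simp: bilinear_def)

lemmas Q_simps =
  linear_add[OF lin_l] linear_add[OF lin_r] linear_diff[OF lin_l] linear_diff[OF lin_r]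
  linear_scale[OF lin_l] linear_scale[OF lin_r] linear_sum[OF lin_l] linear_sum[OF lin_r]
  linear_0[OF lin_l] linear_0[OF lin_r] linear_neg[OF lin_l] linear_neg[OF lin_r]

lemma sum_delta_Q:
  assumes "orthonormal_for Q E" "e \<in> E"
  shows "(\<Sum>a\<in>E. c a * Q a e) = c e"
proof -
  have "(\<Sum>a\<in>E. c a * Q a e) = (\<Sum>a\<in>E. if a = e then c a else 0)"
    using assms by (intro sum.cong) (auto simp: orthonormal_for_def)
  then show ?thesis using assms by (simp add: orthonormal_for_def)
qed

lemma orthonormal_independent:
  assumes "orthonormal_for Q E" shows "independent E"
proof (rule independent_if_scalars_zero)
  show "finite E" using assms by (simp add: orthonormal_for_def)
  fix f x assume s: "(\<Sum>x\<in>E. f x *\<^sub>R x) = 0" and x: "x \<in> E"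
  have "0 = Q (\<Sum>x\<in>E. f x *\<^sub>R x) x" by (simp add: s Q_simps)
  also have "\<dots> = f x" using sum_delta_Q[OF assms x, of f] by (simp add: Q_simps)
  finally show "f x = 0" by simp
qed

text \<open>One Gram-Schmidt step: the residue of \<open>x\<close> is orthogonal to
  \<open>E\<close>, and positive definiteness allows it to be normalised.\<close>

lemma orthonormal_extend:
  assumes E: "orthonormal_for Q E" and y: "x - (\<Sum>e\<in>E. Q x e *\<^sub>R e) \<noteq> 0"
  shows "\<exists>e. e \<notin> E \<and> orthonormal_for Q (insert e E)"
proof -
  define y where "y = x - (\<Sum>e\<in>E. Q x e *\<^sub>R e)"
  have yE: "Q y e = 0" if "e \<in> E" for e
    using sum_delta_Q[OF E that, of "Q x"] by (simp add: y_def Q_simps)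
  have yp: "Q y y > 0" using y pos by (simp add: y_def)
  define e where "e = (1 / sqrt (Q y y)) *\<^sub>R y"
  have ee: "Q e e = 1" using yp by (simp add: e_def Q_simps field_simps)
  have eE: "Q e a = 0" "Q a e = 0" if "a \<in> E" for a
    using yE[OF that] by (auto simp: e_def Q_simps sym[of a])
  have "e \<notin> E" using eE ee by force
  moreover have "orthonormal_for Q (insert e E)"
    using E eE ee \<open>e \<notin> E\<close> by (auto simp: orthonormal_for_def)
  ultimately show ?thesis by blast
qed

lemma orthonormal_exists_card:
  "m \<le> DIM('g) \<Longrightarrow> \<exists>E. orthonormal_for Q E \<and> card E = m"
proof (induction m)
  case 0
  then show ?case by (intro exI[of _ "{}"]) (simp add: orthonormal_for_def)
next
  case (Suc m)
  then obtain E where E: "orthonormal_for Q E" "card E = m" by auto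
  have "\<exists>x. x \<notin> span E"
  proof (rule ccontr)
    assume "\<not> ?thesis"
    then have "span E = UNIV" by auto
    then have "DIM('g) \<le> card E"
      using dim_le_card'[of E] E by (metis dim_UNIV dim_span orthonormal_for_def)
    then show False using Suc.prems E by simp
  qed
  then obtain x where x: "x \<notin> span E" by blast
  have "(\<Sum>e\<in>E. Q x e *\<^sub>R e) \<in> span E" by (intro span_sum span_scale span_base)
  then have "x - (\<Sum>e\<in>E. Q x e *\<^sub>R e) \<noteq> 0" using x by auto
  from orthonormal_extend[OF E(1) this] obtain e where "e \<notin> E" "orthonormal_for Q (insert e E)"
    by blast
  then show ?case using E by (intro exI[of _ "insert e E"]) (auto simp: orthonormal_for_def)
qed

text \<open>A nonzero residue would enlarge \<open>E\<close> to an independent set with more than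
  \<open>DIM('g)\<close> elements.\<close>

lemma orthonormal_expand:
  assumes E: "orthonormal_for Q E" "card E = DIM('g)"
  shows "(\<Sum>e\<in>E. Q x e *\<^sub>R e) = x"
proof (rule ccontr)
  assume "\<not> ?thesis"
  then obtain e where e: "e \<notin> E" "orthonormal_for Q (insert e E)"
    using orthonormal_extend[OF E(1), of x] by force
  have "card (insert e E) \<le> DIM('g)"
    using orthonormal_independent[OF e(2)] independent_card_le by blast
  then show False using e E by (auto simp: orthonormal_for_def)
qed

text \<open>\<open>trace_op\<close> is written in the ambient \<open>Basis\<close>. Expanding each
  ambient basis vector in \<open>E\<close> and regrouping expresses the trace through any other
  positive definite form.\<close>

lemma trace_op_orthonormal:
  assumes E: "orthonormal_for Q E" "card E = DIM('g)" and f: "linear f"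
  shows "trace_op f = (\<Sum>e\<in>E. Q (f e) e)"
proof -
  have "trace_op f = (\<Sum>b\<in>Basis. f (\<Sum>e\<in>E. Q b e *\<^sub>R e) \<bullet> b)"
    by (simp add: trace_op_def orthonormal_expand[OF E])
  also have "\<dots> = (\<Sum>b\<in>Basis. \<Sum>e\<in>E. (f e \<bullet> b) * Q b e)"
    by (simp add: linear_sum[OF f] linear_scale[OF f] inner_sum_left mult.commute)
  also have "\<dots> = (\<Sum>e\<in>E. \<Sum>b\<in>Basis. (f e \<bullet> b) * Q b e)" by (rule sum.swap)
  also have "\<dots> = (\<Sum>e\<in>E. Q (\<Sum>b\<in>Basis. (f e \<bullet> b) *\<^sub>R b) e)" by (simp add: Q_simps)
  finally show ?thesis by (simp add: euclidean_representation)
qed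

end

lemma trace_op_commute:
  fixes f g :: "'a::euclidean_space \<Rightarrow> 'a"
  assumes f: "linear f" and g: "linear g"
  shows "trace_op (\<lambda>x. f (g x)) = trace_op (\<lambda>x. g (f x))"
proof -
  have *: "trace_op (\<lambda>x. f (g x)) = (\<Sum>b\<in>Basis. \<Sum>c\<in>Basis. (g b \<bullet> c) * (f c \<bullet> b))"
    if f: "linear f" for f g :: "'a \<Rightarrow> 'a"
  proof -
    have "f (g b) = (\<Sum>c\<in>Basis. (g b \<bullet> c) *\<^sub>R f c)" for b
      by (subst (1) euclidean_representation[of "g b", symmetric])
        (simp add: linear_sum[OF f] linear_scale[OF f])
    then show ?thesis by (simp add: trace_op_def inner_sum_left)
  qed
  show ?thesis
    unfolding *[OF f] *[OF g] by (subst sum.swap) (simp add: mult.commute)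
qed

section \<open>Invariance and definiteness of the Killing form; contractions over an orthonormal
  basis\<close>

locale compact_simple =
  fixes br :: "'g::euclidean_space \<Rightarrow> 'g \<Rightarrow> 'g"
  assumes compact: "compact_lie_algebra br" and simple: "simple_lie_algebra br"
begin

lemma br_bilin: "bilinear br"
  using simple by (simp add: simple_lie_algebra_def lie_algebra_def)

lemma br_lin_l: "linear (\<lambda>x. br x y)" and br_lin_r: "linear (\<lambda>y. br x y)"
  using br_bilin by (auto simp: bilinear_def)

lemmas br_simps [simp] =
  linear_add[OF br_lin_l] linear_add[OF br_lin_r] linear_diff[OF br_lin_l] linear_diff[OF br_lin_r]
  linear_scale[OF br_lin_l] linear_scale[OF br_lin_r]
  linear_0[OF br_lin_l] linear_0[OF br_lin_r] linear_neg[OF br_lin_l] linear_neg[OF br_lin_r]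

lemmas br_sum = linear_sum[OF br_lin_l] linear_sum[OF br_lin_r]

lemma br_self [simp]: "br x x = 0"
  using simple by (simp add: simple_lie_algebra_def lie_algebra_def)

lemma br_skew: "br y x = - br x y"
proof -
  have "br (x + y) (x + y) = br x y + br y x"
    by (simp del: br_self) simp
  then show ?thesis by (simp add: add_eq_0_iff)
qed

lemma jacobi: "br x (br y z) + br y (br z x) + br z (br x y) = 0"
  using simple by (simp add: simple_lie_algebra_def lie_algebra_def)

lemma br_der: "br x (br y z) = br (br x y) z + br y (br x z)"
proof -
  have "br z (br x y) = - br (br x y) z" "br y (br z x) = - br y (br x z)"
    by (simp_all add: br_skew[of z])
  then show ?thesis using jacobi[of x y z] by (simp add: algebra_simps)
qed

lemma killing_bilin: "bilinear (killing br)"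
  unfolding bilinear_def killing_def trace_op_def
  by (auto intro!: linearI simp: inner_add_left sum.distrib sum_distrib_left)

lemma br_comp_lin: "linear (\<lambda>z. br x (br y z))"
  by (intro linearI) simp_all

lemma killing_sym: "killing br x y = killing br y x"
  unfolding killing_def by (rule trace_op_commute) (rule br_lin_r)+

text \<open>With the adjoint action of a bracket written as a commutator, two of the four traces
  cancel. The other two differ by a cyclic permutation of the factors.\<close>

lemma killing_invariant: "killing br (br x y) z + killing br y (br x z) = 0"
proof -
  have t: "trace_op (\<lambda>v. f v - g v) = trace_op f - trace_op g" for f g :: "'g \<Rightarrow> 'g"
    by (simp add: trace_op_def inner_diff_left sum_subtractf)
  have ad: "br (br a b) c = br a (br b c) - br b (br a c)" for a b c
    using br_der[of a b c] by simp
  have "trace_op (\<lambda>v. br x (br y (br z v))) = trace_op (\<lambda>v. br y (br z (br x v)))"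
    using trace_op_commute[OF br_lin_r[of x] br_comp_lin[of y z]] .
  then show ?thesis unfolding killing_def ad by (simp add: t)
qed

text \<open>The centre is an ideal, and it is not everything because some bracket is
  nonzero.\<close>

lemma center_trivial:
  assumes "\<And>y. br x y = 0" shows "x = 0"
proof -
  define I where "I = {x. \<forall>y. br x y = 0}"
  have "lie_ideal br I"
    unfolding lie_ideal_def
  proof (intro conjI allI impI)
    show "subspace I" by (auto simp: I_def subspace_def)
    fix a b assume b: "b \<in> I"
    then have "br a b = 0" using br_skew[of a b] by (simp add: I_def)
    then show "br a b \<in> I" by (simp add: I_def)
  qed
  moreover have "I \<noteq> UNIV" using simple by (auto simp: I_def simple_lie_algebra_def)
  ultimately have "I = {0}" using simple by (auto simp: simple_lie_algebra_def)
  then show ?thesis using assms by (auto simp: I_def)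
qed

text \<open>Compactness only provides some invariant positive definite \<open>Q\<close>. With
  respect to \<open>Q\<close> the adjoint action is skew, so \<open>killing br x x\<close> is minus
  a sum of squared lengths of brackets; if it vanished, \<open>x\<close> would be central.\<close>

lemma killing_neg:
  assumes "x \<noteq> 0" shows "killing br x x < 0"
proof -
  from compact obtain Q :: "'g \<Rightarrow> 'g \<Rightarrow> real" where Q: "bilinear Q" "\<And>x y. Q x y = Q y x"
     "\<And>x. x \<noteq> 0 \<Longrightarrow> Q x x > 0" and inv: "\<And>x y z. Q (br x y) z + Q y (br x z) = 0"
    unfolding compact_lie_algebra_def by blast
  interpret Q: pos_def_form Q by unfold_locales (use Q in auto)
  obtain E where E: "orthonormal_for Q E" "card E = DIM('g)"
    using Q.orthonormal_exists_card by blast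
  have nn: "Q y y \<ge> 0" for y
    using Q(3)[of y] by (cases "y = 0") (auto simp: Q.Q_simps)
  have "killing br x x = (\<Sum>e\<in>E. Q (br x (br x e)) e)"
    unfolding killing_def by (rule Q.trace_op_orthonormal[OF E br_comp_lin])
  also have "\<dots> = - (\<Sum>e\<in>E. Q (br x e) (br x e))"
  proof -
    have "Q (br x (br x e)) e = - Q (br x e) (br x e)" for e
      using inv[of x "br x e" e] by simp
    then show ?thesis by (simp add: sum_negf)
  qed
  finally have k: "killing br x x = - (\<Sum>e\<in>E. Q (br x e) (br x e))" .
  have "(\<Sum>e\<in>E. Q (br x e) (br x e)) \<noteq> 0"
  proof
    assume "(\<Sum>e\<in>E. Q (br x e) (br x e)) = 0"
    then have "\<forall>e\<in>E. Q (br x e) (br x e) = 0"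
      using E nn by (subst (asm) sum_nonneg_eq_0_iff) (auto simp: orthonormal_for_def)
    then have z: "br x e = 0" if "e \<in> E" for e
      using Q(3)[of "br x e"] that by force
    have "br x y = 0" for y
    proof -
      have "br x y = br x (\<Sum>e\<in>E. Q y e *\<^sub>R e)" by (simp add: Q.orthonormal_expand[OF E])
      also have "\<dots> = 0" by (simp add: br_sum z)
      finally show ?thesis .
    qed
    then show False using center_trivial assms by blast
  qed
  moreover have "(\<Sum>e\<in>E. Q (br x e) (br x e)) \<ge> 0" using nn by (intro sum_nonneg)
  ultimately show ?thesis using k by linarith
qed

sublocale kip: pos_def_form "kip br"
proof
  show "bilinear (kip br)"
    using killing_bilin unfolding kip_def bilinear_def by (auto intro: linear_compose_neg)
qed (auto simp: kip_def killing_sym killing_neg)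

declare kip.Q_simps [simp]
text \<open>The two rules that move sums out of \<open>kip br\<close> are applied explicitly
  instead.\<close>

declare kip.Q_simps(7,8) [simp del]

lemma kip_inv: "kip br (br x y) z = - kip br y (br x z)"
  using killing_invariant[of x y z] by (simp add: kip_def)

lemma kip_cyclic: "kip br x (br y z) = kip br y (br z x)"
  using kip_inv[of z y x] kip.sym[of x] br_skew[of y z] by simp

lemma is_onb_onb: "is_onb br (onb br)"
proof -
  obtain E where "orthonormal_for (kip br) E" "card E = DIM('g)"
    using kip.orthonormal_exists_card by blast
  then have "is_onb br E" by (simp add: is_onb_def orthonormal_for_def)
  then show ?thesis unfolding onb_def by (rule someI)
qed

lemma onb: "orthonormal_for (kip br) (onb br)" "card (onb br) = DIM('g)"
  using is_onb_onb by (auto simp: is_onb_def orthonormal_for_def)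

lemma finite_onb [simp]: "finite (onb br)"
  using is_onb_onb by (simp add: is_onb_def)

lemmas expand = kip.orthonormal_expand[OF onb]

lemma linear_expand:
  fixes f :: "'g \<Rightarrow> 'b::real_vector"
  assumes f: "linear f"
  shows "(\<Sum>a\<in>onb br. kip br x a *\<^sub>R f a) = f x"
proof -
  have "(\<Sum>a\<in>onb br. kip br x a *\<^sub>R f a) = f (\<Sum>a\<in>onb br. kip br x a *\<^sub>R a)"
    by (simp add: linear_sum[OF f] linear_scale[OF f])
  then show ?thesis by (simp add: expand)
qed

lemma linear_expand':
  fixes f :: "'g \<Rightarrow> real"
  assumes f: "linear f"
  shows "(\<Sum>a\<in>onb br. kip br x a * f a) = f x" "(\<Sum>a\<in>onb br. f a * kip br x a) = f x"
    "(\<Sum>a\<in>onb br. kip br a x * f a) = f x" "(\<Sum>a\<in>onb br. f a * kip br a x) = f x"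
  using linear_expand[OF f, of x] by (simp_all add: mult.commute kip.sym[of _ x])

text \<open>Invariance of the canonical element, the sum of \<open>e_a \<otimes> e_a\<close>: the
  adjoint action is skew, so it changes sign when moved from one factor to the other. The
  equivariance of every contraction below rests on this.\<close>

lemma contract_inv:
  fixes G :: "'g \<Rightarrow> 'g \<Rightarrow> 'b::real_vector"
  assumes G: "bilinear G"
  shows "(\<Sum>a\<in>onb br. G (br x a) a) = - (\<Sum>a\<in>onb br. G a (br x a))"
proof -
  have l: "linear (\<lambda>u. G u v)" and r: "linear (\<lambda>v. G u v)" for u v
    using G by (auto simp: bilinear_def)
  have skew: "kip br (br x b) a = - kip br (br x a) b" for a b
    by (metis kip_inv kip.sym)
  have "(\<Sum>a\<in>onb br. G (br x a) a) = (\<Sum>a\<in>onb br. \<Sum>b\<in>onb br. kip br (br x a) b *\<^sub>R G b a)"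
    by (simp add: linear_expand[OF l])
  also have "\<dots> = (\<Sum>b\<in>onb br. \<Sum>a\<in>onb br. kip br (br x a) b *\<^sub>R G b a)"
    by (rule sum.swap)
  also have "\<dots> = (\<Sum>b\<in>onb br. - (\<Sum>a\<in>onb br. kip br (br x b) a *\<^sub>R G b a))"
    by (subst skew) (simp add: sum_negf)
  also have "\<dots> = - (\<Sum>b\<in>onb br. G b (br x b))"
    by (simp add: linear_expand[OF r] sum_negf)
  finally show ?thesis .
qed

text \<open>The Casimir operator of the adjoint representation. The constant is -1 because the inner
  product is exactly minus the trace form of that representation.\<close>

lemma casimir: "(\<Sum>a\<in>onb br. br a (br a x)) = - x"
proof -
  have "kip br (\<Sum>a\<in>onb br. br a (br a x)) y = - kip br x y" for y
  proof -
    have "kip br x y = - (\<Sum>a\<in>onb br. kip br (br x (br y a)) a)"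
      unfolding kip_def[of _ x y] killing_def kip.trace_op_orthonormal[OF onb br_comp_lin] ..
    also have "\<dots> = (\<Sum>a\<in>onb br. kip br (br a y) (br a x))"
    proof -
      have "kip br (br x (br y a)) a = - kip br (br a y) (br a x)" for a
        using kip_inv[of x "br y a" a] by (simp add: br_skew[of _ a])
      then show ?thesis by (simp add: sum_negf)
    qed
    also have "\<dots> = - kip br (\<Sum>a\<in>onb br. br a (br a x)) y"
      by (simp add: kip.Q_simps(7) kip_inv sum_negf kip.sym[of y])
    finally show ?thesis by simp
  qed
  then have "kip br ((\<Sum>a\<in>onb br. br a (br a x)) + x) y = 0" for y by simp
  then show ?thesis using kip.pos[of "(\<Sum>a\<in>onb br. br a (br a x)) + x"]
    by (metis add_eq_0_iff less_irrefl add.commute)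
qed

text \<open>The Casimir identity again: contracting the exact 2-form of \<open>w\<close> with the
  bracket returns \<open>w\<close> with constant one. This fixes the correction terms in
  \<open>proj_form\<close> and \<open>wedge_tensor\<close>.\<close>

lemma contract_d: "(\<Sum>a\<in>onb br. \<Sum>b\<in>onb br. kip br w (br a b) *\<^sub>R br a b) = w"
proof -
  have "(\<Sum>b\<in>onb br. kip br w (br a b) *\<^sub>R br a b) = - br a (br a w)" for a
  proof -
    have "kip br w (br a b) = - kip br (br a w) b" for b by (simp add: kip_inv)
    then show ?thesis using linear_expand[OF br_lin_r, of "br a w" a] by (simp add: sum_negf)
  qed
  then show ?thesis by (simp add: sum_negf casimir)
qed

end

subsection \<open>Linear algebra of forms\<close>

text \<open>As simp rules, these would turn unapplied sums and differences of forms into abstractions.\<close>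
declare plus_fun_apply [simp del] zero_fun_apply [simp del] minus_apply [simp del]

lemma fscale_apply: "fscale c \<phi> xs = c * \<phi> xs"
  by (simp add: fscale_def)

lemma interior_apply: "interior x \<phi> xs = \<phi> (x # xs)"
  by (simp add: interior_def)

lemmas fapply = fscale_apply interior_apply plus_fun_apply zero_fun_apply minus_apply

lemma zero_form_eq: "zero_form = 0"
  by (simp add: zero_form_def fun_eq_iff fapply)

lemma fadd_eq: "fadd \<phi> \<psi> = \<phi> + \<psi>"
  by (simp add: fadd_def fun_eq_iff fapply)

lemma sum_apply: "(\<Sum>i\<in>I. f i) x = (\<Sum>i\<in>I. f i x)" for f :: "'i \<Rightarrow> 'a \<Rightarrow> real"
  by (induction I rule: infinite_finite_induct) (auto simp: fapply)

text \<open>Provides span, independence and dimension for sets of forms.\<close>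

interpretation fvs: vector_space "fscale :: real \<Rightarrow> 'g form \<Rightarrow> 'g form"
  by unfold_locales (auto simp: fun_eq_iff algebra_simps fapply)

lemma fsubspace_iff: "fsubspace U \<longleftrightarrow> fvs.subspace U"
  by (auto simp: fsubspace_def fvs.subspace_def zero_form_eq fadd_eq)

lemma multilinear_form_0: "multilinear_form 0 \<phi> \<longleftrightarrow> (\<forall>xs. xs \<noteq> [] \<longrightarrow> \<phi> xs = 0)"
proof
  assume z: "\<forall>xs. xs \<noteq> [] \<longrightarrow> \<phi> xs = 0"
  have "linear (\<lambda>v. \<phi> (xs[i := v]))" if "i < length xs" for xs i
  proof -
    have "\<phi> (xs[i := v]) = 0" for v using z that by (cases xs) (auto split: nat.split)
    then show ?thesis by (auto intro: linearI)
  qed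
  then show "multilinear_form 0 \<phi>" using z by (auto simp: multilinear_form_def)
qed (auto simp: multilinear_form_def)

text \<open>Splitting off the first argument allows induction on the degree, with
  \<open>interior\<close> as the descent.\<close>

lemma multilinear_form_Suc:
  "multilinear_form (Suc k) \<phi> \<longleftrightarrow>
     \<phi> [] = 0 \<and> (\<forall>x. multilinear_form k (interior x \<phi>)) \<and> (\<forall>xs. linear (\<lambda>x. \<phi> (x # xs)))"
  (is "_ \<longleftrightarrow> ?R")
proof
  assume l: "multilinear_form (Suc k) \<phi>"
  have "linear (\<lambda>v. interior x \<phi> (xs[i := v]))" if "i < length xs" for x xs i
    using l[unfolded multilinear_form_def, THEN conjunct2, rule_format, of "Suc i" "x # xs"] that
    by (simp add: fapply)
  moreover have "linear (\<lambda>v. \<phi> (v # xs))" for xs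
    using l[unfolded multilinear_form_def, THEN conjunct2, rule_format, of "0" "undefined # xs"]
    by simp
  ultimately show ?R using l by (auto simp: multilinear_form_def fapply)
next
  assume r: ?R
  have "linear (\<lambda>v. \<phi> (xs[i := v]))" if "i < length xs" for xs i
  proof (cases xs)
    case (Cons y ys)
    then show ?thesis using r that
      by (cases i) (auto simp: multilinear_form_def fapply)
  qed (use that in auto)
  moreover have "\<phi> xs = 0" if "length xs \<noteq> Suc k" for xs
    using r that by (cases xs) (auto simp: multilinear_form_def fapply)
  ultimately show "multilinear_form (Suc k) \<phi>" by (auto simp: multilinear_form_def)
qed

lemma interior_add: "interior x (\<phi> + \<psi>) = interior x \<phi> + interior x \<psi>"
  and interior_scale: "interior x (fscale c \<phi>) = fscale c (interior x \<phi>)"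
  and interior_zero: "interior x 0 = 0"
  by (auto simp: fun_eq_iff fapply)

lemma subspace_multilinear: "fvs.subspace {\<phi> :: ('g::euclidean_space) form. multilinear_form k \<phi>}"
proof (induction k)
  case 0
  show ?case unfolding fvs.subspace_def by (auto simp: multilinear_form_0 fapply)
next
  case (Suc k)
  have 1: "linear (\<lambda>x. f x + g x)" if "linear f" "linear g" for f g :: "'g \<Rightarrow> real"
    using that by (auto intro!: linearI simp: linear_add linear_scale algebra_simps)
  have 2: "linear (\<lambda>x. c * f x)" if "linear f" for f :: "'g \<Rightarrow> real" and c
    using that by (auto intro!: linearI simp: linear_add linear_scale algebra_simps)
  have 3: "linear (\<lambda>x::'g. 0::real)" by (auto intro: linearI)
  from 1 2 3 show ?case using Suc
    unfolding fvs.subspace_def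
    by (auto simp: multilinear_form_Suc interior_add interior_scale interior_zero fapply)
qed

lemma Lam_multilinear: "\<phi> \<in> Lam k \<Longrightarrow> multilinear_form k \<phi>"
  by (simp add: Lam_def)

lemma multilinear_length: "multilinear_form k \<phi> \<Longrightarrow> length xs \<noteq> k \<Longrightarrow> \<phi> xs = 0"
  by (simp add: multilinear_form_def)

lemma der_act_Nil [simp]: "der_act A \<phi> [] = 0"
  by (simp add: der_act_def)

lemma der_act_Cons [simp]:
  "der_act A \<phi> (x # xs) = - \<phi> (A x # xs) + der_act A (interior x \<phi>) xs"
  unfolding der_act_def by (simp only: list.size sum.lessThan_Suc_shift o_def add_0_right add_Suc_right
    nth_Cons_0 nth_Cons_Suc list_update_code interior_apply minus_add_distrib)

lemma der_act_zero: "der_act A 0 = 0"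
  and der_act_add: "der_act A (\<phi> + \<psi>) = der_act A \<phi> + der_act A \<psi>"
  and der_act_scale: "der_act A (fscale c \<phi>) = fscale c (der_act A \<phi>)"
  by (auto simp: fun_eq_iff der_act_def sum.distrib sum_distrib_left fapply)

lemma interior_der_act:
  "interior x (der_act A \<phi>) = der_act A (interior x \<phi>) - interior (A x) \<phi>"
  by (auto simp: fun_eq_iff fapply)

lemma multilinear_der_act:
  assumes A: "linear A"
  shows "multilinear_form k \<phi> \<Longrightarrow> multilinear_form k (der_act A \<phi>)"
proof (induction k arbitrary: \<phi>)
  case 0
  then show ?case by (auto simp: multilinear_form_0 der_act_def)
next
  case (Suc k)
  have l: "\<And>xs. linear (\<lambda>x. \<phi> (x # xs))" and k: "\<And>x. multilinear_form k (interior x \<phi>)"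
    using Suc.prems by (auto simp: multilinear_form_Suc)
  have "linear (\<lambda>x. der_act A \<phi> (x # xs))" for xs
  proof -
    have 1: "linear (\<lambda>x. \<phi> (A x # xs))" using linear_compose[OF A l] by (simp add: o_def)
    have 2: "linear (\<lambda>x. der_act A (interior x \<phi>) xs)"
      unfolding der_act_def interior_apply
      by (intro linearI) (simp_all add: linear_add[OF l] linear_scale[OF l] sum.distrib sum_distrib_left)
    show ?thesis using linear_compose_sub[OF 2 1] by simp
  qed
  then show ?case
    unfolding multilinear_form_Suc interior_der_act
    using Suc.IH[OF k] k by (auto intro: fvs.subspace_diff[OF subspace_multilinear, simplified])
qed

lemma gact_zero [simp]: "gact br X 0 = 0"
  and gact_add: "gact br X (\<phi> + \<psi>) = gact br X \<phi> + gact br X \<psi>"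
  and gact_scale: "gact br X (fscale c \<phi>) = fscale c (gact br X \<phi>)"
  by (auto simp: gact_def der_act_zero der_act_add der_act_scale)

lemma gact_diff: "gact br X (\<phi> - \<psi>) = gact br X \<phi> - gact br X \<psi>"
  by (auto simp: gact_def fun_eq_iff der_act_def sum_subtractf fapply)

section \<open>The inner product of forms\<close>

lemma ipf_0: "ipf br 0 \<phi> \<psi> = \<phi> [] * \<psi> []"
proof -
  have "{xs. set xs \<subseteq> onb br \<and> length xs = 0} = {[]}" by auto
  then show ?thesis by (simp add: ipf_def)
qed

lemma ipf_Suc: "ipf br (Suc k) \<phi> \<psi> = (\<Sum>a\<in>onb br. ipf br k (interior a \<phi>) (interior a \<psi>))"
proof -
  have inj: "inj_on (\<lambda>(xs, n). n # xs) S" for S :: "('a list \<times> 'a) set" by (auto simp: inj_on_def)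
  show ?thesis
    unfolding ipf_def lists_length_Suc_eq sum.reindex[OF inj]
    by (simp add: case_prod_beta sum.cartesian_product' fapply) (rule sum.swap)
qed

lemma ipf_sym: "ipf br k \<phi> \<psi> = ipf br k \<psi> \<phi>"
  by (simp add: ipf_def mult.commute)

lemma ipf_add_l: "ipf br k (\<phi> + \<phi>') \<psi> = ipf br k \<phi> \<psi> + ipf br k \<phi>' \<psi>"
  and ipf_diff_l: "ipf br k (\<phi> - \<phi>') \<psi> = ipf br k \<phi> \<psi> - ipf br k \<phi>' \<psi>"
  and ipf_scale_l: "ipf br k (fscale c \<phi>) \<psi> = c * ipf br k \<phi> \<psi>"
  and ipf_zero_l: "ipf br k 0 \<psi> = 0"
  by (simp_all add: ipf_def fapply algebra_simps sum.distrib sum_subtractf sum_distrib_left)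

lemma ipf_add_r: "ipf br k \<psi> (\<phi> + \<phi>') = ipf br k \<psi> \<phi> + ipf br k \<psi> \<phi>'"
  and ipf_diff_r: "ipf br k \<psi> (\<phi> - \<phi>') = ipf br k \<psi> \<phi> - ipf br k \<psi> \<phi>'"
  and ipf_scale_r: "ipf br k \<psi> (fscale c \<phi>) = c * ipf br k \<psi> \<phi>"
  and ipf_zero_r: "ipf br k \<psi> 0 = 0"
  by (simp_all add: ipf_def fapply algebra_simps sum.distrib sum_subtractf sum_distrib_left)

lemmas ipf_simps = ipf_add_l ipf_diff_l ipf_scale_l ipf_zero_l ipf_add_r ipf_diff_r ipf_scale_r ipf_zero_r

context compact_simple
begin

abbreviation tuples :: "nat \<Rightarrow> 'g list set" where
  "tuples k \<equiv> {xs. set xs \<subseteq> onb br \<and> length xs = k}"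

lemma finite_tuples: "finite (tuples k)"
  by (rule finite_lists_length_eq) simp

text \<open>The elementary tensors dual to tuples of vectors. For tuples from \<open>onb br\<close>
  they span the \<open>k\<close>-linear forms, which are therefore finite-dimensional.\<close>

fun dual :: "'g list \<Rightarrow> 'g form" where
  "dual (y # ys) (x # xs) = kip br x y * dual ys xs"
| "dual [] [] = 1"
| "dual _ _ = 0"

lemma multilinear_expand:
  "multilinear_form k \<phi> \<Longrightarrow> \<phi> xs = (\<Sum>ys\<in>tuples k. \<phi> ys * dual ys xs)"
proof (induction k arbitrary: \<phi> xs)
  case 0
  have "tuples 0 = {[]}" by auto
  then show ?case using 0 by (cases xs) (auto simp: multilinear_form_0)
next
  case (Suc k)
  have inj: "inj_on (\<lambda>(xs, n). n # xs) S" for S :: "('g list \<times> 'g) set" by (auto simp: inj_on_def)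
  have s: "(\<Sum>ys\<in>tuples (Suc k). \<phi> ys * dual ys xs)
      = (\<Sum>ys\<in>tuples k. \<Sum>y\<in>onb br. \<phi> (y # ys) * dual (y # ys) xs)"
    unfolding lists_length_Suc_eq sum.reindex[OF inj]
    by (simp add: case_prod_beta sum.cartesian_product')
  show ?case
  proof (cases xs)
    case Nil
    then show ?thesis using Suc.prems unfolding s by (simp add: multilinear_form_Suc)
  next
    case (Cons z zs)
    have l: "\<And>xs. linear (\<lambda>x. \<phi> (x # xs))" and k: "\<And>x. multilinear_form k (interior x \<phi>)"
      using Suc.prems by (auto simp: multilinear_form_Suc)
    have "(\<Sum>y\<in>onb br. \<phi> (y # ys) * dual (y # ys) xs) = \<phi> (z # ys) * dual ys zs" for ys
    proof -
      have "(\<Sum>y\<in>onb br. \<phi> (y # ys) * dual (y # ys) xs)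
          = (\<Sum>y\<in>onb br. kip br z y * \<phi> (y # ys)) * dual ys zs"
        unfolding sum_distrib_right by (simp add: Cons mult_ac)
      then show ?thesis by (simp add: linear_expand'(1)[OF l])
    qed
    then show ?thesis using Suc.IH[OF k, of z zs] unfolding s by (simp add: Cons fapply)
  qed
qed

lemma multilinear_in_span:
  assumes "multilinear_form k \<phi>" shows "\<phi> \<in> fvs.span (dual ` tuples k)"
proof -
  have "\<phi> = (\<Sum>ys\<in>tuples k. fscale (\<phi> ys) (dual ys))"
    by (simp add: fun_eq_iff sum_apply fapply multilinear_expand[OF assms, symmetric])
  also have "\<dots> \<in> fvs.span (dual ` tuples k)"
    by (intro fvs.span_sum fvs.span_scale fvs.span_base) auto
  finally show ?thesis .
qed

lemma ipf_nonneg: "ipf br k \<phi> \<phi> \<ge> 0"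
  by (simp add: ipf_def sum_nonneg)

text \<open>A multilinear form is determined by its values on tuples of basis vectors, and these are
  exactly the values that \<open>ipf\<close> sees.\<close>

lemma ipf_definite:
  assumes "multilinear_form k \<phi>" "ipf br k \<phi> \<phi> = 0" shows "\<phi> = 0"
proof -
  have "\<phi> ys = 0" if "ys \<in> tuples k" for ys
    using assms(2) that finite_tuples[of k] unfolding ipf_def
    by (subst (asm) sum_nonneg_eq_0_iff) auto
  then have "\<phi> xs = 0" for xs by (subst multilinear_expand[OF assms(1)]) simp
  then show ?thesis by (simp add: fun_eq_iff fapply)
qed

lemma multilinear_gact: "multilinear_form k \<phi> \<Longrightarrow> multilinear_form k (gact br X \<phi>)"
  unfolding gact_def by (rule multilinear_der_act[OF br_lin_r])

text \<open>Induction on the degree: the first slot is handled by \<open>contract_inv\<close>, the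
  remaining ones by the induction hypothesis.\<close>

lemma ipf_gact:
  "multilinear_form k \<phi> \<Longrightarrow> multilinear_form k \<psi> \<Longrightarrow>
    ipf br k (gact br X \<phi>) \<psi> = - ipf br k \<phi> (gact br X \<psi>)"
proof (induction k arbitrary: \<phi> \<psi>)
  case 0
  then show ?case by (simp add: ipf_0 gact_def)
next
  case (Suc k)
  have l: "\<And>xs. linear (\<lambda>x. \<phi> (x # xs))" "\<And>xs. linear (\<lambda>x. \<psi> (x # xs))"
    and k: "\<And>x. multilinear_form k (interior x \<phi>)" "\<And>x. multilinear_form k (interior x \<psi>)"
    using Suc.prems by (auto simp: multilinear_form_Suc)
  have "bilinear (\<lambda>a b. ipf br k (interior a \<phi>) (interior b \<psi>))"
    unfolding bilinear_def ipf_def interior_apply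
    by (auto intro!: linearI simp: linear_add[OF l(1)] linear_add[OF l(2)] linear_scale[OF l(1)]
        linear_scale[OF l(2)] algebra_simps sum.distrib sum_distrib_left)
  note contract_inv[OF this, of X]
  moreover have "ipf br (Suc k) (gact br X \<phi>) \<psi> =
      (\<Sum>a\<in>onb br. ipf br k (gact br X (interior a \<phi>)) (interior a \<psi>))
      - (\<Sum>a\<in>onb br. ipf br k (interior (br X a) \<phi>) (interior a \<psi>))"
    by (simp add: ipf_Suc gact_def interior_der_act ipf_diff_l sum_subtractf)
  moreover have "ipf br (Suc k) \<phi> (gact br X \<psi>) =
      (\<Sum>a\<in>onb br. ipf br k (interior a \<phi>) (gact br X (interior a \<psi>)))
      - (\<Sum>a\<in>onb br. ipf br k (interior a \<phi>) (interior (br X a) \<psi>))"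
    by (simp add: ipf_Suc gact_def interior_der_act ipf_diff_r sum_subtractf)
  moreover have "(\<Sum>a\<in>onb br. ipf br k (gact br X (interior a \<phi>)) (interior a \<psi>))
      = - (\<Sum>a\<in>onb br. ipf br k (interior a \<phi>) (gact br X (interior a \<psi>)))"
    by (simp only: Suc.IH[OF k] sum_negf)
  ultimately show ?case by linarith
qed

section \<open>Dimension and orthogonal projection in spaces of forms\<close>

lemma subspace_finite_basis:
  fixes V :: "'g form set"
  assumes V: "fvs.subspace V" and k: "\<And>\<phi>. \<phi> \<in> V \<Longrightarrow> multilinear_form k \<phi>"
  obtains B where "finite B" "fvs.independent B" "fvs.span B = V"
proof -
  obtain B where B: "B \<subseteq> V" "fvs.independent B" "V \<subseteq> fvs.span B"
    using fvs.maximal_independent_subset[of V] by blast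
  have "B \<subseteq> fvs.span (dual ` tuples k)" using B(1) k multilinear_in_span by blast
  then have "finite B"
    using fvs.independent_span_bound[OF finite_imageI[OF finite_tuples] B(2)] by blast
  moreover have "fvs.span B = V" using B fvs.span_subspace[OF _ _ V] by blast
  ultimately show ?thesis using that B(2) by blast
qed

text \<open>The decrease on which the induction in \<open>orthogonal_decomposition\<close>
  runs.\<close>

lemma dim_less:
  fixes V M :: "'g form set"
  assumes V: "fvs.subspace V" and M: "fvs.subspace M" and VM: "V \<subset> M"
    and k: "\<And>\<phi>. \<phi> \<in> M \<Longrightarrow> multilinear_form k \<phi>"
  shows "fvs.dim V < fvs.dim M"
proof -
  obtain B where B: "finite B" "fvs.independent B" "fvs.span B = V"
    using subspace_finite_basis[OF V, of k] VM k by blast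
  obtain C where C: "finite C" "fvs.independent C" "fvs.span C = M"
    using subspace_finite_basis[OF M, of k] k by blast
  obtain x where x: "x \<in> M" "x \<notin> V" using VM by blast
  have "fvs.independent (insert x B)" "x \<notin> B"
    using fvs.independent_insertI[of x B] B(2,3) x(2) fvs.span_base[of x B] by blast+
  moreover have "insert x B \<subseteq> fvs.span C" using B C x VM fvs.span_base by blast
  ultimately have "Suc (card B) \<le> card C"
    using fvs.independent_span_bound[OF C(1), of "insert x B"] B(1) by simp
  moreover have "fvs.dim V = card B" "fvs.dim M = card C"
    using fvs.dim_eq_card[of B V] fvs.dim_eq_card[of C M] B C fvs.span_eq_iff V M by metis+
  ultimately show ?thesis by simp
qed

text \<open>Gram-Schmidt as an induction over a finite spanning set: the new generator
  \<open>a\<close> is replaced by its part \<open>b\<close> orthogonal to the span of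
  \<open>S\<close>, and the projection of \<open>x\<close> gains a multiple of
  \<open>b\<close>.\<close>

lemma projection_span:
  fixes S :: "'g form set"
  assumes "finite S" "\<And>\<phi>. \<phi> \<in> S \<Longrightarrow> multilinear_form k \<phi>"
  shows "\<exists>v\<in>fvs.span S. \<forall>u\<in>fvs.span S. ipf br k (x - v) u = 0"
  using assms
proof (induction S arbitrary: x rule: finite_induct)
  case empty
  then show ?case by (auto simp: ipf_zero_r)
next
  case (insert a S)
  have sp: "fvs.span (insert a S) = {y. \<exists>c. y - fscale c a \<in> fvs.span S}"
    by (rule fvs.span_insert)
  obtain a' where a': "a' \<in> fvs.span S" "\<forall>u\<in>fvs.span S. ipf br k (a - a') u = 0"
    using insert by blast
  obtain x' where x': "x' \<in> fvs.span S" "\<forall>u\<in>fvs.span S. ipf br k (x - x') u = 0"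
    using insert by blast
  have "fvs.span S \<subseteq> {\<phi>. multilinear_form k \<phi>}"
    by (rule fvs.span_minimal) (use insert subspace_multilinear in auto)
  then have mS: "multilinear_form k \<phi>" if "\<phi> \<in> fvs.span S" for \<phi> using that by blast
  define b where "b = a - a'"
  have "multilinear_form k b"
    unfolding b_def using insert.prems[of a] mS[OF a'(1)]
      fvs.subspace_diff[OF subspace_multilinear] by blast
  then have b: "b = 0" if "ipf br k b b = 0" using that ipf_definite by blast
  \<comment> \<open>If \<open>ipf br k b b\<close> is zero, the quotient has the default value 0;
    then \<open>b\<close> vanishes as well, so nothing is added.\<close>
  define c where "c = ipf br k (x - x') b / ipf br k b b"
  define v where "v = x' + fscale c b"
  have bs: "b \<in> fvs.span (insert a S)"
    unfolding b_def using a'(1) fvs.span_mono[of S "insert a S"]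
    by (auto intro!: fvs.span_diff intro: fvs.span_base)
  have "v \<in> fvs.span (insert a S)"
    unfolding v_def using x'(1) bs fvs.span_mono[of S "insert a S"]
    by (auto intro!: fvs.span_add fvs.span_scale)
  moreover have "ipf br k (x - v) u = 0" if u: "u \<in> fvs.span (insert a S)" for u
  proof -
    obtain d where d: "u - fscale d a \<in> fvs.span S" using u sp by blast
    \<comment> \<open>Splitting \<open>u\<close> along \<open>b\<close> instead of \<open>a\<close>
      leaves a part in the span of \<open>S\<close>, so that orthogonality can be tested separately
      against \<open>s\<close> and \<open>b\<close>.\<close>
    define s where "s = u - fscale d b"
    have "s = (u - fscale d a) + fscale d a'"
      by (simp add: s_def b_def fun_eq_iff algebra_simps fapply)
    then have s: "s \<in> fvs.span S" using d a'(1) by (auto intro: fvs.span_add fvs.span_scale)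
    have 1: "ipf br k (x - v) s = 0"
    proof -
      have "x - v = (x - x') - fscale c b" by (simp add: v_def)
      then have "ipf br k (x - v) s = ipf br k (x - x') s - c * ipf br k b s"
        by (simp only: ipf_diff_l[of _ _ "x - x'"] ipf_scale_l)
      then show ?thesis using s x' a' by (simp add: b_def)
    qed
    have 2: "ipf br k (x - v) b = 0"
    proof (cases "ipf br k b b = 0")
      case True
      then show ?thesis using b by (simp add: ipf_simps)
    next
      case False
      have "x - v = (x - x') - fscale c b" by (simp add: v_def)
      then have "ipf br k (x - v) b = ipf br k (x - x') b - c * ipf br k b b"
        by (simp only: ipf_diff_l[of _ _ "x - x'"] ipf_scale_l)
      then show ?thesis using False by (simp add: c_def)
    qed
    have "u = s + fscale d b" by (simp add: s_def fun_eq_iff fapply)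
    then show ?thesis using 1 2 by (simp add: ipf_add_r ipf_scale_r)
  qed
  ultimately show ?case by blast
qed

lemma projection:
  fixes V :: "'g form set"
  assumes V: "fvs.subspace V" and k: "\<And>\<phi>. \<phi> \<in> V \<Longrightarrow> multilinear_form k \<phi>"
  obtains v where "v \<in> V" "\<And>u. u \<in> V \<Longrightarrow> ipf br k (x - v) u = 0"
proof -
  obtain B where B: "finite B" "fvs.span B = V"
    using subspace_finite_basis[OF V k] by metis
  then have "B \<subseteq> V" using fvs.span_superset by blast
  then have "\<exists>v\<in>V. \<forall>u\<in>V. ipf br k (x - v) u = 0"
    using projection_span[OF B(1), of k x] k unfolding B(2) by blast
  then show ?thesis using that by blast
qed

end

subsection \<open>Modules and orthogonal decompositions\<close>

lemma submodule_iff: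
  "submodule br M U \<longleftrightarrow> fvs.subspace U \<and> U \<subseteq> M \<and> (\<forall>X. \<forall>u\<in>U. gact br X u \<in> U)"
  by (simp add: submodule_def fsubspace_iff)

text \<open>The conditions are imposed on \<open>S\<close> only: the maps below are total functions
  on forms, and their equivariance is established for multilinear forms.\<close>

definition module_hom_on ::
    "('g::euclidean_space \<Rightarrow> 'g \<Rightarrow> 'g) \<Rightarrow> 'g form set \<Rightarrow> ('g form \<Rightarrow> 'g form) \<Rightarrow> bool" where
  "module_hom_on br S h \<longleftrightarrow> (\<forall>x\<in>S. \<forall>y\<in>S. h (x + y) = h x + h y) \<and>
     (\<forall>c. \<forall>x\<in>S. h (fscale c x) = fscale c (h x)) \<and>
     (\<forall>X. \<forall>x\<in>S. h (gact br X x) = gact br X (h x))"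

lemma module_hom_onD:
  assumes "module_hom_on br S h"
  shows "x \<in> S \<Longrightarrow> y \<in> S \<Longrightarrow> h (x + y) = h x + h y"
    and "x \<in> S \<Longrightarrow> h (fscale c x) = fscale c (h x)"
    and "x \<in> S \<Longrightarrow> h (gact br X x) = gact br X (h x)"
  using assms by (auto simp: module_hom_on_def)

lemma module_hom_on_subset: "module_hom_on br S h \<Longrightarrow> T \<subseteq> S \<Longrightarrow> module_hom_on br T h"
  by (auto simp: module_hom_on_def subset_iff)

lemma fscale_0: "fscale 0 x = 0" and fscale_minus1: "x + fscale (-1) y = x - y"
  by (simp_all add: fun_eq_iff fapply)

lemma module_hom_on_0:
  assumes "module_hom_on br S h" "x \<in> S" shows "h 0 = 0"
  using module_hom_onD(2)[OF assms, of 0] by (simp add: fscale_0)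

lemma module_hom_on_diff:
  assumes h: "module_hom_on br S h" and S: "fvs.subspace S" and x: "x \<in> S" and y: "y \<in> S"
  shows "h (x - y) = h x - h y"
  using module_hom_onD(1)[OF h x fvs.subspace_scale[OF S y, of "-1"]] module_hom_onD(2)[OF h y, of "-1"]
  by (simp only: fscale_minus1)

lemma module_hom_on_inj:
  assumes h: "module_hom_on br S h" and S: "fvs.subspace S"
    and ker: "\<And>x. x \<in> S \<Longrightarrow> h x = 0 \<Longrightarrow> x = 0"
  shows "inj_on h S"
proof (rule inj_onI)
  fix x y assume "x \<in> S" "y \<in> S" "h x = h y"
  then have "h (x - y) = 0" using module_hom_on_diff[OF h S] by simp
  then have "x - y = 0" using ker fvs.subspace_diff[OF S \<open>x \<in> S\<close> \<open>y \<in> S\<close>] by blast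
  then show "x = y" by simp
qed

lemma submodule_image:
  assumes S: "submodule br S S" and h: "module_hom_on br S h"
  shows "submodule br (h ` S) (h ` S)"
proof -
  have sub: "fvs.subspace S" and g: "\<And>X u. u \<in> S \<Longrightarrow> gact br X u \<in> S"
    using S by (auto simp: submodule_iff)
  have "fvs.subspace (h ` S)"
  proof (rule fvs.subspaceI)
    show "0 \<in> h ` S"
      using module_hom_on_0[OF h fvs.subspace_0[OF sub]] fvs.subspace_0[OF sub] by force
    show "x + y \<in> h ` S" if "x \<in> h ` S" "y \<in> h ` S" for x y
      using that module_hom_onD(1)[OF h, symmetric] fvs.subspace_add[OF sub] by auto
    show "fscale c x \<in> h ` S" if "x \<in> h ` S" for c x
      using that module_hom_onD(2)[OF h, symmetric] fvs.subspace_scale[OF sub] by auto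
  qed
  then show ?thesis
    using g module_hom_onD(3)[OF h, symmetric] by (auto simp: submodule_iff)
qed

lemma module_iso_image:
  assumes h: "module_hom_on br S h" and inj: "inj_on h S"
  shows "module_iso br S (h ` S)"
  unfolding module_iso_def fadd_eq
  using module_hom_onD[OF h] inj by (intro exI[of _ h]) (auto simp: bij_betw_def)

text \<open>The inverse of an injective homomorphism is again a homomorphism; claims (2) and (3)
  need the isomorphism in this direction.\<close>

lemma module_iso_image_sym:
  assumes S: "submodule br S S" and h: "module_hom_on br S h" and inj: "inj_on h S"
  shows "module_iso br (h ` S) S"
proof -
  have sub: "fvs.subspace S" and g: "\<And>X u. u \<in> S \<Longrightarrow> gact br X u \<in> S"
    using S by (auto simp: submodule_iff)
  define f where "f = the_inv_into S h"
  have f: "f (h x) = x" if "x \<in> S" for x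
    using that inj by (simp add: f_def the_inv_into_f_f)
  have "f (h x + h y) = f (h x) + f (h y)" if "x \<in> S" "y \<in> S" for x y
    using f[OF fvs.subspace_add[OF sub that]] f that by (simp only: module_hom_onD(1)[OF h])
  moreover have "f (fscale c (h x)) = fscale c (f (h x))" if "x \<in> S" for x c
    using f[OF fvs.subspace_scale[OF sub that]] f that by (simp only: module_hom_onD(2)[OF h])
  moreover have "f (gact br X (h x)) = gact br X (f (h x))" if "x \<in> S" for x X
    using f[OF g[OF that]] f that by (simp only: module_hom_onD(3)[OF h])
  moreover have "bij_betw f (h ` S) S"
    unfolding f_def by (rule bij_betw_the_inv_into) (use inj in \<open>auto simp: bij_betw_def\<close>)
  ultimately show ?thesis
    unfolding module_iso_def fadd_eq by (intro exI[of _ f]) auto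
qed

text \<open>A submodule of the image pulls back along \<open>h\<close> to a submodule of
  \<open>V\<close>, where irreducibility applies.\<close>

lemma irreducible_image:
  assumes V: "irreducible_module br V" and h: "module_hom_on br V h" and inj: "inj_on h V"
  shows "irreducible_module br (h ` V)"
proof -
  have S: "submodule br V V" "V \<noteq> {0}"
    and irr: "\<And>W. submodule br V W \<Longrightarrow> W = {0} \<or> W = V"
    using V by (auto simp: irreducible_module_def zero_form_eq)
  have sub: "fvs.subspace V" and g: "\<And>X u. u \<in> V \<Longrightarrow> gact br X u \<in> V"
    using S by (auto simp: submodule_iff)
  have 0: "0 \<in> V" "h 0 = 0"
    using fvs.subspace_0[OF sub] module_hom_on_0[OF h fvs.subspace_0[OF sub]] by auto
  have "W = {0} \<or> W = h ` V" if W: "submodule br (h ` V) W" for W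
  proof -
    define W' where "W' = {v \<in> V. h v \<in> W}"
    have Ws: "fvs.subspace W" "W \<subseteq> h ` V" and Wg: "\<And>X u. u \<in> W \<Longrightarrow> gact br X u \<in> W"
      using W by (auto simp: submodule_iff)
    have hW: "h ` W' = W" using Ws by (auto simp: W'_def)
    have "fvs.subspace W'"
    proof (rule fvs.subspaceI)
      show "0 \<in> W'" using 0 fvs.subspace_0[OF Ws(1)] by (simp add: W'_def)
      show "x + y \<in> W'" if "x \<in> W'" "y \<in> W'" for x y
        using that fvs.subspace_add[OF sub] fvs.subspace_add[OF Ws(1)] module_hom_onD(1)[OF h]
        by (simp add: W'_def)
      show "fscale c x \<in> W'" if "x \<in> W'" for c x
        using that fvs.subspace_scale[OF sub] fvs.subspace_scale[OF Ws(1)] module_hom_onD(2)[OF h]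
        by (simp add: W'_def)
    qed
    moreover have "gact br X u \<in> W'" if "u \<in> W'" for X u
      using that g Wg module_hom_onD(3)[OF h] by (simp add: W'_def)
    ultimately have "submodule br V W'" by (auto simp: submodule_iff W'_def)
    then have "W' = {0} \<or> W' = V" by (rule irr)
    then show ?thesis using hW 0 by auto
  qed
  moreover have "h ` V \<noteq> {0}"
  proof
    assume "h ` V = {0}"
    then have "x = 0" if "x \<in> V" for x using that inj 0 by (metis imageI inj_onD singletonD)
    then show False using S(2) 0 by auto
  qed
  ultimately show ?thesis
    using submodule_image[OF S(1) h] by (simp add: irreducible_module_def zero_form_eq)
qed

context compact_simple
begin

text \<open>By \<open>ipf_gact\<close> the action can be moved onto the second argument, where it
  preserves \<open>V\<close>.\<close>

lemma orth_complement_submodule: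
  assumes M: "submodule br M M" and V: "submodule br M V"
    and k: "\<And>\<phi>. \<phi> \<in> M \<Longrightarrow> multilinear_form k \<phi>"
  shows "submodule br M {x \<in> M. \<forall>v\<in>V. ipf br k x v = 0}" (is "submodule br M ?C")
proof -
  have sub: "fvs.subspace M" and g: "\<And>X u. u \<in> M \<Longrightarrow> gact br X u \<in> M"
    using M by (auto simp: submodule_iff)
  have Vg: "\<And>X u. u \<in> V \<Longrightarrow> gact br X u \<in> V" and VM: "V \<subseteq> M"
    using V by (auto simp: submodule_iff)
  have "fvs.subspace ?C"
    using fvs.subspace_0[OF sub] fvs.subspace_add[OF sub] fvs.subspace_scale[OF sub]
    by (intro fvs.subspaceI) (auto simp: ipf_simps)
  moreover have "gact br X u \<in> ?C" if "u \<in> ?C" for X u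
    using that g Vg VM ipf_gact[OF k k] by auto
  ultimately show ?thesis by (auto simp: submodule_iff)
qed

text \<open>Strong induction on the dimension: a nonzero submodule of least dimension is
  irreducible, and its orthogonal complement is a smaller module. Pairwise orthogonality is recorded
  because it later yields uniqueness of the components.\<close>

lemma orthogonal_decomposition:
  assumes "submodule br M M" "M \<subseteq> Collect (multilinear_form k)"
  shows "\<exists>(m::nat) V. (\<forall>i<m. irreducible_module br (V i) \<and> V i \<subseteq> M) \<and>
     (\<forall>i<m. \<forall>j<m. i \<noteq> j \<longrightarrow> (\<forall>x\<in>V i. \<forall>y\<in>V j. ipf br k x y = 0)) \<and>
     (\<forall>T\<in>M. \<exists>v. (\<forall>i<m. v i \<in> V i) \<and> T = (\<Sum>i<m. v i))"
  using assms
proof (induction "fvs.dim M" arbitrary: M rule: less_induct)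
  case less
  have sub: "fvs.subspace M" using less.prems by (simp add: submodule_iff)
  have Mk: "multilinear_form k \<phi>" if "\<phi> \<in> M" for \<phi> using that less.prems(2) by blast
  show ?case
  proof (cases "M = {0}")
    case True
    then show ?thesis by (intro exI[of _ 0]) auto
  next
    case False
    define P where "P V \<longleftrightarrow> submodule br M V \<and> V \<noteq> {0}" for V
    have "P M" using False less.prems by (simp add: P_def)
    then obtain V where V: "P V" and min: "\<And>V'. P V' \<Longrightarrow> fvs.dim V \<le> fvs.dim V'"
      using ex_has_least_nat[of P M "fvs.dim"] by blast
    have VM: "submodule br M V" "V \<noteq> {0}" using V by (auto simp: P_def)
    then have Vs: "fvs.subspace V" "V \<subseteq> M" and VV: "submodule br V V" by (auto simp: submodule_iff)
    have Vk: "multilinear_form k \<phi>" if "\<phi> \<in> V" for \<phi> using that Vs Mk by blast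
    have irr: "irreducible_module br V"
      unfolding irreducible_module_def zero_form_eq
    proof (intro conjI VV VM(2) allI impI)
      fix W assume W: "submodule br V W"
      show "W = {0} \<or> W = V"
      proof (rule ccontr)
        assume n: "\<not> ?thesis"
        have Ws: "fvs.subspace W" "W \<subset> V" using W n by (auto simp: submodule_iff)
        have "P W" using W n Vs by (auto simp: P_def submodule_iff)
        moreover have "fvs.dim W < fvs.dim V" using dim_less[OF Ws(1) Vs(1) Ws(2) Vk] .
        ultimately show False using min[of W] by simp
      qed
    qed
    define M' where "M' = {x \<in> M. \<forall>v\<in>V. ipf br k x v = 0}"
    have M'M: "submodule br M M'"
      unfolding M'_def by (rule orth_complement_submodule[OF less.prems(1) VM(1) Mk])
    then have M': "submodule br M' M'" "fvs.subspace M'" "M' \<subseteq> M" by (auto simp: submodule_iff)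
    \<comment> \<open>A nonzero element of \<open>V\<close> is not orthogonal to itself, so the
      complement is strictly smaller.\<close>
    obtain x where x: "x \<in> V" "x \<noteq> 0" using VM(2) fvs.subspace_0[OF Vs(1)] by blast
    then have "x \<notin> M'" using ipf_definite[OF Vk] by (auto simp: M'_def)
    then have "M' \<subset> M" using x Vs M' by blast
    then have dim: "fvs.dim M' < fvs.dim M" by (rule dim_less[OF M'(2) sub _ Mk])
    have M'k: "M' \<subseteq> Collect (multilinear_form k)" using M'(3) Mk by blast
    obtain m :: nat and U where
      U: "\<forall>i<m. irreducible_module br (U i) \<and> U i \<subseteq> M'"
      and orth: "\<forall>i<m. \<forall>j<m. i \<noteq> j \<longrightarrow> (\<forall>x\<in>U i. \<forall>y\<in>U j. ipf br k x y = 0)"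
      and dec: "\<forall>T\<in>M'. \<exists>v. (\<forall>i<m. v i \<in> U i) \<and> T = (\<Sum>i<m. v i)"
      using less.hyps[OF dim M'(1) M'k] by (elim exE conjE) rule
    define U' where "U' i = (if i = m then V else U i)" for i
    have c1: "\<forall>i<Suc m. irreducible_module br (U' i) \<and> U' i \<subseteq> M"
      using U irr Vs M' by (auto simp: U'_def less_Suc_eq)
    have c2: "\<forall>i<Suc m. \<forall>j<Suc m. i \<noteq> j \<longrightarrow> (\<forall>x\<in>U' i. \<forall>y\<in>U' j. ipf br k x y = 0)"
    proof (intro allI impI ballI)
      fix i j x y assume a: "i < Suc m" "j < Suc m" "i \<noteq> j" "x \<in> U' i" "y \<in> U' j"
      have *: "ipf br k x y = 0" if "x \<in> V" "y \<in> U j" "j < m" for x y j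
        using that U by (subst ipf_sym) (auto simp: M'_def)
      consider "i < m" "j < m" | "i = m" "j < m" | "i < m" "j = m" using a by linarith
      then show "ipf br k x y = 0"
        by cases (use a orth *[of x y j] *[of y x i] ipf_sym[of br k x y] in \<open>auto simp: U'_def\<close>)
    qed
    have c3: "\<exists>v. (\<forall>i<Suc m. v i \<in> U' i) \<and> T = (\<Sum>i<Suc m. v i)" if T: "T \<in> M" for T
    proof -
      obtain w where w: "w \<in> V" "\<And>u. u \<in> V \<Longrightarrow> ipf br k (T - w) u = 0"
        using projection[OF Vs(1) Vk] by blast
      have "T - w \<in> M'" using w T Vs fvs.subspace_diff[OF sub] by (auto simp: M'_def)
      then obtain v where v: "\<forall>i<m. v i \<in> U i" "T - w = (\<Sum>i<m. v i)" using dec by blast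
      define v' where "v' i = (if i = m then w else v i)" for i
      have "(\<Sum>i<Suc m. v' i) = (\<Sum>i<m. v i) + w"
        by (auto simp: v'_def intro!: sum.cong)
      then have "T = (\<Sum>i<Suc m. v' i)" using v(2) by (metis diff_add_cancel)
      moreover have "\<forall>i<Suc m. v' i \<in> U' i" using v w by (auto simp: v'_def U'_def less_Suc_eq)
      ultimately show ?thesis by blast
    qed
    show ?thesis
      by (intro exI[of _ "Suc m"] exI[of _ U'] conjI ballI) (rule c1, rule c2, rule c3)
  qed
qed

text \<open>Subtract from \<open>h\<close> its orthogonal projection to \<open>W\<close>. The result
  still lies in \<open>N\<close> and vanishes only where \<open>h\<close> takes values in
  \<open>W\<close>, so it embeds \<open>S\<close> into the complement of \<open>W\<close>; its image
  is the required \<open>U\<close>.\<close>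

lemma orthogonal_lift:
  assumes N: "submodule br N N" and W: "submodule br N W"
    and k: "\<And>\<phi>. \<phi> \<in> N \<Longrightarrow> multilinear_form k \<phi>"
    and S: "submodule br S S" and h: "module_hom_on br S h"
    and hN: "\<And>s. s \<in> S \<Longrightarrow> h s \<in> N" and hW: "\<And>s. s \<in> S \<Longrightarrow> h s \<in> W \<Longrightarrow> s = 0"
  shows "\<exists>U. submodule br {x \<in> N. \<forall>w\<in>W. ipf br k x w = 0} U \<and> module_iso br U S"
proof -
  have Ns: "fvs.subspace N" and Ng: "\<And>X u. u \<in> N \<Longrightarrow> gact br X u \<in> N"
    using N by (auto simp: submodule_iff)
  have Ws: "fvs.subspace W" "W \<subseteq> N" and Wg: "\<And>X u. u \<in> W \<Longrightarrow> gact br X u \<in> W"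
    using W by (auto simp: submodule_iff)
  have Wk: "multilinear_form k \<phi>" if "\<phi> \<in> W" for \<phi> using that k Ws by blast
  have Ss: "fvs.subspace S" and Sg: "\<And>X u. u \<in> S \<Longrightarrow> gact br X u \<in> S"
    using S by (auto simp: submodule_iff)
  have uniq: "v = v'" if "v \<in> W" "v' \<in> W" "\<forall>u\<in>W. ipf br k (x - v) u = 0"
    "\<forall>u\<in>W. ipf br k (x - v') u = 0" for x v v'
  proof -
    have d: "v - v' \<in> W" using fvs.subspace_diff[OF Ws(1)] that by blast
    have "ipf br k (v - v') (v - v') = ipf br k (x - v') (v - v') - ipf br k (x - v) (v - v')"
      unfolding ipf_diff_l by simp
    then have "ipf br k (v - v') (v - v') = 0" using d that by simp
    then show ?thesis using ipf_definite[OF Wk[OF d]] by simp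
  qed
  \<comment> \<open>Defining the projection by its characterising property makes it additive,
    homogeneous and equivariant: in each case the expected value satisfies the property, and
    \<open>p_eq\<close> identifies it.\<close>
  define p where "p x = (THE v. v \<in> W \<and> (\<forall>u\<in>W. ipf br k (x - v) u = 0))" for x
  have p_eq: "p x = v" if "v \<in> W" "\<forall>u\<in>W. ipf br k (x - v) u = 0" for x v
    unfolding p_def
  proof (rule the_equality)
    show "v' = v" if "v' \<in> W \<and> (\<forall>u\<in>W. ipf br k (x - v') u = 0)" for v'
      using uniq[of v' v x] that \<open>v \<in> W\<close> \<open>\<forall>u\<in>W. ipf br k (x - v) u = 0\<close> by simp
  qed (use that in auto)
  have pW: "p x \<in> W" and p0: "u \<in> W \<Longrightarrow> ipf br k (x - p x) u = 0" for x u
  proof -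
    obtain v where v: "v \<in> W" "\<And>u. u \<in> W \<Longrightarrow> ipf br k (x - v) u = 0"
      using projection[OF Ws(1) Wk] by blast
    then have "p x = v" by (intro p_eq) auto
    then show "p x \<in> W" "u \<in> W \<Longrightarrow> ipf br k (x - p x) u = 0" using v by auto
  qed
  define q where "q s = h s - p (h s)" for s
  have q: "module_hom_on br S q"
    unfolding module_hom_on_def
  proof (intro conjI ballI allI)
    fix s t assume st: "s \<in> S" "t \<in> S"
    have "p (h s + h t) = p (h s) + p (h t)"
    proof (rule p_eq)
      show "p (h s) + p (h t) \<in> W" using pW fvs.subspace_add[OF Ws(1)] by blast
      have e: "h s + h t - (p (h s) + p (h t)) = (h s - p (h s)) + (h t - p (h t))" by simp
      show "\<forall>u\<in>W. ipf br k (h s + h t - (p (h s) + p (h t))) u = 0"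
        unfolding e by (subst ipf_add_l) (simp add: p0)
    qed
    then show "q (s + t) = q s + q t" using st module_hom_onD(1)[OF h] by (simp add: q_def)
  next
    fix c s assume s: "s \<in> S"
    have "p (fscale c (h s)) = fscale c (p (h s))"
    proof (rule p_eq)
      show "fscale c (p (h s)) \<in> W" using pW fvs.subspace_scale[OF Ws(1)] by blast
      have e: "fscale c (h s) - fscale c (p (h s)) = fscale c (h s - p (h s))"
        by (rule fvs.scale_right_diff_distrib[symmetric])
      show "\<forall>u\<in>W. ipf br k (fscale c (h s) - fscale c (p (h s))) u = 0"
        unfolding e ipf_scale_l by (simp add: p0)
    qed
    then show "q (fscale c s) = fscale c (q s)"
      using s module_hom_onD(2)[OF h] by (simp add: q_def fvs.scale_right_diff_distrib)
  next
    fix X s assume s: "s \<in> S"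
    have "p (gact br X (h s)) = gact br X (p (h s))"
    proof (rule p_eq)
      show "gact br X (p (h s)) \<in> W" using pW Wg by blast
      have "ipf br k (gact br X (h s - p (h s))) u = 0" if u: "u \<in> W" for u
      proof -
        have "multilinear_form k (h s - p (h s))"
          using k fvs.subspace_diff[OF Ns hN[OF s]] pW Ws by blast
        then show ?thesis using ipf_gact[of k _ u X] Wk[OF u] p0[OF Wg[OF u]] by simp
      qed
      then show "\<forall>u\<in>W. ipf br k (gact br X (h s) - gact br X (p (h s))) u = 0"
        by (simp add: gact_diff)
    qed
    then show "q (gact br X s) = gact br X (q s)"
      using s module_hom_onD(3)[OF h] by (simp add: q_def gact_diff)
  qed
  have "inj_on q S"
  proof (rule module_hom_on_inj[OF q Ss])
    fix s assume s: "s \<in> S" "q s = 0"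
    then have "h s = p (h s)" by (simp add: q_def)
    then show "s = 0" using hW[OF s(1)] pW by metis
  qed
  moreover have "q ` S \<subseteq> {x \<in> N. \<forall>w\<in>W. ipf br k x w = 0}"
  proof
    fix y assume "y \<in> q ` S"
    then obtain s where s: "s \<in> S" "y = h s - p (h s)" by (auto simp: q_def)
    have "y \<in> N" unfolding s(2) using hN[OF s(1)] pW[of "h s"] Ws(2) by (intro fvs.subspace_diff[OF Ns]) auto
    then show "y \<in> {x \<in> N. \<forall>w\<in>W. ipf br k x w = 0}" using p0[of _ "h s"] s(2) by simp
  qed
  ultimately show ?thesis
    using submodule_image[OF S q] module_iso_image_sym[OF S q]
    by (intro exI[of _ "q ` S"]) (auto simp: submodule_iff)
qed

end

subsection \<open>Forms of low degree\<close>

lemma length2E: "length xs = 2 \<Longrightarrow> (\<And>x y. xs = [x, y] \<Longrightarrow> P) \<Longrightarrow> P"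
  and length3E: "length xs = 3 \<Longrightarrow> (\<And>x y z. xs = [x, y, z] \<Longrightarrow> P) \<Longrightarrow> P"
  and length4E: "length xs = 4 \<Longrightarrow> (\<And>w x y z. xs = [w, x, y, z] \<Longrightarrow> P) \<Longrightarrow> P"
  by (auto simp: numeral_eq_Suc length_Suc_conv)

lemma form_eqI:
  assumes "multilinear_form k \<phi>" "multilinear_form k \<psi>"
    and "\<And>xs. length xs = k \<Longrightarrow> \<phi> xs = \<psi> xs"
  shows "\<phi> = \<psi>"
  using assms unfolding multilinear_form_def fun_eq_iff by metis

lemma multilinear_formI:
  assumes len: "\<And>xs. length xs \<noteq> k \<Longrightarrow> \<phi> xs = 0"
    and lin: "\<And>xs i. length xs = k \<Longrightarrow> i < k \<Longrightarrow> linear (\<lambda>v. \<phi> (xs[i := v]))"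
  shows "multilinear_form k \<phi>"
  unfolding multilinear_form_def
proof (intro conjI allI impI len)
  fix xs :: "'a list" and i assume "i < length xs"
  then show "linear (\<lambda>v. \<phi> (xs[i := v]))"
    using lin[of xs i] len[of "xs[i := _]"] by (cases "length xs = k") (auto intro: linearI)
qed

lemma multilinear_form_2I:
  assumes "\<And>xs. length xs \<noteq> 2 \<Longrightarrow> \<phi> xs = 0"
    and "\<And>y. linear (\<lambda>x. \<phi> [x, y])" "\<And>x. linear (\<lambda>y. \<phi> [x, y])"
  shows "multilinear_form 2 \<phi>"
proof (intro multilinear_formI assms(1))
  fix xs :: "'a list" and i :: nat assume "length xs = 2" "i < 2"
  then show "linear (\<lambda>v. \<phi> (xs[i := v]))"
    using assms(2-) by (elim length2E) (auto simp: numeral_eq_Suc less_Suc_eq)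
qed

lemma multilinear_form_3I:
  assumes "\<And>xs. length xs \<noteq> 3 \<Longrightarrow> \<phi> xs = 0"
    and "\<And>y z. linear (\<lambda>x. \<phi> [x, y, z])" "\<And>x z. linear (\<lambda>y. \<phi> [x, y, z])"
      "\<And>x y. linear (\<lambda>z. \<phi> [x, y, z])"
  shows "multilinear_form 3 \<phi>"
proof (intro multilinear_formI assms(1))
  fix xs :: "'a list" and i :: nat assume "length xs = 3" "i < 3"
  then show "linear (\<lambda>v. \<phi> (xs[i := v]))"
    using assms(2-) by (elim length3E) (auto simp: numeral_eq_Suc less_Suc_eq)
qed

lemma multilinear_form_4I:
  assumes "\<And>xs. length xs \<noteq> 4 \<Longrightarrow> \<phi> xs = 0"
    and "\<And>x y z. linear (\<lambda>w. \<phi> [w, x, y, z])" "\<And>w y z. linear (\<lambda>x. \<phi> [w, x, y, z])"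
      "\<And>w x z. linear (\<lambda>y. \<phi> [w, x, y, z])" "\<And>w x y. linear (\<lambda>z. \<phi> [w, x, y, z])"
  shows "multilinear_form 4 \<phi>"
proof (intro multilinear_formI assms(1))
  fix xs :: "'a list" and i :: nat assume "length xs = 4" "i < 4"
  then show "linear (\<lambda>v. \<phi> (xs[i := v]))"
    using assms(2-) by (elim length4E) (auto simp: numeral_eq_Suc less_Suc_eq)
qed

lemma multilinear_2_linear:
  assumes "multilinear_form 2 \<phi>"
  shows "linear (\<lambda>x. \<phi> [x, y])" "linear (\<lambda>y. \<phi> [x, y])"
  using assms[unfolded multilinear_form_def, THEN conjunct2, rule_format, of 0 "[x, y]" for x y]
    assms[unfolded multilinear_form_def, THEN conjunct2, rule_format, of 1 "[x, y]" for x y]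
  by (auto simp: numeral_eq_Suc)

lemma multilinear_3_linear:
  assumes "multilinear_form 3 \<phi>"
  shows "linear (\<lambda>x. \<phi> [x, y, z])" "linear (\<lambda>y. \<phi> [x, y, z])" "linear (\<lambda>z. \<phi> [x, y, z])"
  using assms[unfolded multilinear_form_def, THEN conjunct2, rule_format, of 0 "[x, y, z]" for x y z]
    assms[unfolded multilinear_form_def, THEN conjunct2, rule_format, of 1 "[x, y, z]" for x y z]
    assms[unfolded multilinear_form_def, THEN conjunct2, rule_format, of 2 "[x, y, z]" for x y z]
  by (auto simp: numeral_eq_Suc)

lemma multilinear_2_simps:
  assumes \<phi>: "multilinear_form 2 \<phi>"
  shows "\<phi> [x + x', y] = \<phi> [x, y] + \<phi> [x', y]" "\<phi> [x, y + y'] = \<phi> [x, y] + \<phi> [x, y']"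
    "\<phi> [x - x', y] = \<phi> [x, y] - \<phi> [x', y]" "\<phi> [x, y - y'] = \<phi> [x, y] - \<phi> [x, y']"
    "\<phi> [- x, y] = - \<phi> [x, y]" "\<phi> [x, - y] = - \<phi> [x, y]"
    "\<phi> [c *\<^sub>R x, y] = c * \<phi> [x, y]" "\<phi> [x, c *\<^sub>R y] = c * \<phi> [x, y]"
    "\<phi> [0, y] = 0" "\<phi> [x, 0] = 0"
  by (simp_all add: linear_add[OF multilinear_2_linear(1)[OF \<phi>]]
      linear_add[OF multilinear_2_linear(2)[OF \<phi>]]
      linear_diff[OF multilinear_2_linear(1)[OF \<phi>]]
      linear_diff[OF multilinear_2_linear(2)[OF \<phi>]]
      linear_neg[OF multilinear_2_linear(1)[OF \<phi>]]
      linear_neg[OF multilinear_2_linear(2)[OF \<phi>]]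
      linear_scale[OF multilinear_2_linear(1)[OF \<phi>]]
      linear_scale[OF multilinear_2_linear(2)[OF \<phi>]]
      linear_0[OF multilinear_2_linear(1)[OF \<phi>]]
      linear_0[OF multilinear_2_linear(2)[OF \<phi>]])

lemma multilinear_3_simps:
  assumes \<phi>: "multilinear_form 3 \<phi>"
  shows "\<phi> [x + x', y, z] = \<phi> [x, y, z] + \<phi> [x', y, z]" "\<phi> [x, y + y', z] = \<phi> [x, y, z] + \<phi> [x, y', z]"
    "\<phi> [x, y, z + z'] = \<phi> [x, y, z] + \<phi> [x, y, z']"
    "\<phi> [x - x', y, z] = \<phi> [x, y, z] - \<phi> [x', y, z]" "\<phi> [x, y - y', z] = \<phi> [x, y, z] - \<phi> [x, y', z]"
    "\<phi> [x, y, z - z'] = \<phi> [x, y, z] - \<phi> [x, y, z']"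
    "\<phi> [- x, y, z] = - \<phi> [x, y, z]" "\<phi> [x, - y, z] = - \<phi> [x, y, z]" "\<phi> [x, y, - z] = - \<phi> [x, y, z]"
    "\<phi> [c *\<^sub>R x, y, z] = c * \<phi> [x, y, z]" "\<phi> [x, c *\<^sub>R y, z] = c * \<phi> [x, y, z]"
    "\<phi> [x, y, c *\<^sub>R z] = c * \<phi> [x, y, z]"
    "\<phi> [0, y, z] = 0" "\<phi> [x, 0, z] = 0" "\<phi> [x, y, 0] = 0"
  by (simp_all add: linear_add[OF multilinear_3_linear(1)[OF \<phi>]]
      linear_add[OF multilinear_3_linear(2)[OF \<phi>]]
      linear_add[OF multilinear_3_linear(3)[OF \<phi>]]
      linear_diff[OF multilinear_3_linear(1)[OF \<phi>]]
      linear_diff[OF multilinear_3_linear(2)[OF \<phi>]]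
      linear_diff[OF multilinear_3_linear(3)[OF \<phi>]]
      linear_neg[OF multilinear_3_linear(1)[OF \<phi>]]
      linear_neg[OF multilinear_3_linear(2)[OF \<phi>]]
      linear_neg[OF multilinear_3_linear(3)[OF \<phi>]]
      linear_scale[OF multilinear_3_linear(1)[OF \<phi>]]
      linear_scale[OF multilinear_3_linear(2)[OF \<phi>]]
      linear_scale[OF multilinear_3_linear(3)[OF \<phi>]]
      linear_0[OF multilinear_3_linear(1)[OF \<phi>]]
      linear_0[OF multilinear_3_linear(2)[OF \<phi>]]
      linear_0[OF multilinear_3_linear(3)[OF \<phi>]])

lemma Lam_2_iff: "\<phi> \<in> Lam 2 \<longleftrightarrow> multilinear_form 2 \<phi> \<and> (\<forall>x. \<phi> [x, x] = 0)" (is "?L \<longleftrightarrow> ?R")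
proof
  assume L: ?L
  then have "\<phi> [x, x] = 0" for x
  proof -
    have "\<And>xs i j. i < j \<Longrightarrow> j < length xs \<Longrightarrow> xs ! i = xs ! j \<Longrightarrow> \<phi> xs = 0"
      using L by (auto simp: Lam_def)
    from this[of 0 1 "[x, x]"] show ?thesis by simp
  qed
  then show ?R using L by (auto simp: Lam_def)
next
  assume R: ?R
  have "\<phi> xs = 0" if "i < j" "j < length xs" "xs ! i = xs ! j" for xs i j
  proof (cases "length xs = 2")
    case True
    then obtain x y where xs: "xs = [x, y]" by (rule length2E)
    then have "i = 0" "j = 1" using that by auto
    then show ?thesis using xs R that by simp
  qed (use R in \<open>auto simp: multilinear_form_def\<close>)
  then show ?L using R by (auto simp: Lam_def)
qed

lemma Lam_2_skew: "\<phi> \<in> Lam 2 \<Longrightarrow> \<phi> [y, x] = - \<phi> [x, y]"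
proof -
  assume "\<phi> \<in> Lam 2"
  then have m: "multilinear_form 2 \<phi>" and "\<phi> [x + y, x + y] = 0" "\<phi> [x, x] = 0" "\<phi> [y, y] = 0"
    by (auto simp: Lam_2_iff)
  then show ?thesis by (simp add: multilinear_2_simps[OF m])
qed

lemma Lam_3_zero:
  assumes "\<phi> \<in> Lam 3" shows "\<phi> [x, x, y] = 0" "\<phi> [x, y, x] = 0" "\<phi> [y, x, x] = 0"
proof -
  have a: "\<And>xs i j. i < j \<Longrightarrow> j < length xs \<Longrightarrow> xs ! i = xs ! j \<Longrightarrow> \<phi> xs = 0"
    using assms by (auto simp: Lam_def)
  show "\<phi> [x, x, y] = 0" "\<phi> [x, y, x] = 0" "\<phi> [y, x, x] = 0"
    using a[of 0 1 "[x, x, y]"] a[of 0 2 "[x, y, x]"] a[of 1 2 "[y, x, x]"]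
    by (auto simp: numeral_eq_Suc)
qed

lemma Lam_3_skew:
  assumes \<phi>: "\<phi> \<in> Lam 3" shows "\<phi> [y, x, z] = - \<phi> [x, y, z]" "\<phi> [x, z, y] = - \<phi> [x, y, z]"
    "\<phi> [z, y, x] = - \<phi> [x, y, z]"
proof -
  note m = Lam_multilinear[OF \<phi>]
  show "\<phi> [y, x, z] = - \<phi> [x, y, z]"
    using Lam_3_zero(1)[OF \<phi>, of "x + y" z] Lam_3_zero(1)[OF \<phi>, of x z] Lam_3_zero(1)[OF \<phi>, of y z]
    by (simp add: multilinear_3_simps[OF m])
  show "\<phi> [x, z, y] = - \<phi> [x, y, z]"
    using Lam_3_zero(3)[OF \<phi>, of x "y + z"] Lam_3_zero(3)[OF \<phi>, of x y] Lam_3_zero(3)[OF \<phi>, of x z]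
    by (simp add: multilinear_3_simps[OF m])
  show "\<phi> [z, y, x] = - \<phi> [x, y, z]"
    using Lam_3_zero(2)[OF \<phi>, of "x + z" y] Lam_3_zero(2)[OF \<phi>, of x y] Lam_3_zero(2)[OF \<phi>, of z y]
    by (simp add: multilinear_3_simps[OF m])
qed

lemma Lam_3I:
  assumes m: "multilinear_form 3 \<phi>"
    and z: "\<And>x y. \<phi> [x, x, y] = 0" "\<And>x y. \<phi> [x, y, x] = 0" "\<And>x y. \<phi> [y, x, x] = 0"
  shows "\<phi> \<in> Lam 3"
proof -
  have "\<phi> xs = 0" if ij: "i < j" "j < length xs" "xs ! i = xs ! j" for xs i j
  proof (cases "length xs = 3")
    case True
    then obtain x y w where xs: "xs = [x, y, w]" by (rule length3E)
    then have "(i = 0 \<and> j = 1) \<or> (i = 0 \<and> j = 2) \<or> (i = 1 \<and> j = 2)" using ij by auto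
    then show ?thesis using xs z ij by (auto simp: numeral_eq_Suc)
  qed (use m in \<open>auto simp: multilinear_form_def\<close>)
  then show ?thesis using m by (auto simp: Lam_def)
qed

lemma Lam_4I:
  assumes m: "multilinear_form 4 \<phi>"
    and z: "\<And>x y z. \<phi> [x, x, y, z] = 0" "\<And>x y z. \<phi> [x, y, x, z] = 0" "\<And>x y z. \<phi> [x, y, z, x] = 0"
      "\<And>x y z. \<phi> [y, x, x, z] = 0" "\<And>x y z. \<phi> [y, x, z, x] = 0" "\<And>x y z. \<phi> [y, z, x, x] = 0"
  shows "\<phi> \<in> Lam 4"
proof -
  have "\<phi> xs = 0" if ij: "i < j" "j < length xs" "xs ! i = xs ! j" for xs i j
  proof (cases "length xs = 4")
    case True
    then obtain x y w v where xs: "xs = [x, y, w, v]" by (rule length4E)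
    have "i < j" "j < 4" using ij True by auto
    then have "(i = 0 \<and> j = 1) \<or> (i = 0 \<and> j = 2) \<or> (i = 0 \<and> j = 3)
        \<or> (i = 1 \<and> j = 2) \<or> (i = 1 \<and> j = 3) \<or> (i = 2 \<and> j = 3)"
      by (auto simp: numeral_eq_Suc less_Suc_eq)
    then show ?thesis
      by (elim disjE) (use xs ij(3) z in \<open>simp_all add: numeral_eq_Suc\<close>)
  qed (use m in \<open>auto simp: multilinear_form_def\<close>)
  then show ?thesis using m by (auto simp: Lam_def)
qed

lemma subspace_Lam: "fvs.subspace (Lam k :: ('g::euclidean_space) form set)"
proof (rule fvs.subspaceI)
  note sub = subspace_multilinear[of k, where 'g = 'g]
  show "0 \<in> (Lam k :: 'g form set)"
    using fvs.subspace_0[OF sub] by (simp add: Lam_def zero_fun_apply)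
  show "\<phi> + \<psi> \<in> Lam k" if "\<phi> \<in> Lam k" "\<psi> \<in> Lam k" for \<phi> \<psi> :: "'g form"
    unfolding Lam_def
  proof (intro CollectI conjI allI impI)
    show "multilinear_form k (\<phi> + \<psi>)"
      using fvs.subspace_add[OF sub] Lam_multilinear that by blast
    fix xs :: "'g list" and i j assume "i < j \<and> j < length xs \<and> xs ! i = xs ! j"
    then have "\<phi> xs = 0" "\<psi> xs = 0" using that unfolding Lam_def by blast+
    then show "(\<phi> + \<psi>) xs = 0" by (simp add: plus_fun_apply)
  qed
  show "fscale c \<phi> \<in> Lam k" if "\<phi> \<in> Lam k" for c and \<phi> :: "'g form"
    unfolding Lam_def
  proof (intro CollectI conjI allI impI)
    show "multilinear_form k (fscale c \<phi>)"
      using fvs.subspace_scale[OF sub] Lam_multilinear that by blast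
    fix xs :: "'g list" and i j assume "i < j \<and> j < length xs \<and> xs ! i = xs ! j"
    then have "\<phi> xs = 0" using that unfolding Lam_def by blast
    then show "fscale c \<phi> xs = 0" by (simp add: fscale_apply)
  qed
qed

text \<open>If arguments \<open>i\<close> and \<open>j\<close> coincide, only the terms
  differentiating one of these two slots survive. Their sum is the polarisation of
  \<open>f p p = 0\<close> in the directions \<open>u\<close> and \<open>v\<close>.\<close>

lemma Lam_der_act:
  assumes A: "linear A" and \<phi>: "\<phi> \<in> Lam k"
  shows "der_act A \<phi> \<in> Lam k"
proof -
  have m: "multilinear_form k \<phi>" using \<phi> by (rule Lam_multilinear)
  have alt: "\<phi> ys = 0" if "i < j" "j < length ys" "ys ! i = ys ! j" for ys i j
    using \<phi> that by (auto simp: Lam_def)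
  have lin: "linear (\<lambda>v. \<phi> (ys[i := v]))" if "i < length ys" for ys i
    using m that by (auto simp: multilinear_form_def)
  have "der_act A \<phi> xs = 0" if ij: "i < j" "j < length xs" "xs ! i = xs ! j" for xs i j
  proof -
    define u v where "u = xs ! i" and "v = A u"
    define f where "f p q = \<phi> (xs[i := p, j := q])" for p q
    have f0: "f p p = 0" for p
      unfolding f_def by (rule alt[of i j]) (use ij in auto)
    have l2: "linear (\<lambda>q. f p q)" for p
      unfolding f_def by (rule lin) (use ij in auto)
    have l1: "linear (\<lambda>p. f p q)" for q
    proof -
      have "xs[i := p, j := q] = xs[j := q, i := p]" for p using ij by (intro list_update_swap) simp
      then show ?thesis unfolding f_def using ij lin[of i "xs[j := q]"] by simp
    qed
    have "f (u + v) (u + v) = f u u + f v v + (f v u + f u v)"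
      by (simp add: linear_add[OF l1] linear_add[OF l2])
    then have s: "f v u + f u v = 0" by (simp add: f0)
    have xu: "xs ! i = u" "xs ! j = u" using ij by (auto simp: u_def)
    have fi: "f v u = \<phi> (xs[i := A (xs ! i)])" "f u v = \<phi> (xs[j := A (xs ! j)])"
    proof -
      have "xs[i := u] = xs" "xs[j := u] = xs" using list_update_id[of xs i] list_update_id[of xs j] xu by auto
      moreover have "xs[i := v, j := u] = xs[j := u, i := v]" using ij by (intro list_update_swap) simp
      ultimately show "f v u = \<phi> (xs[i := A (xs ! i)])" "f u v = \<phi> (xs[j := A (xs ! j)])"
        unfolding f_def xu by (simp_all add: v_def)
    qed
    have "(\<Sum>l<length xs. \<phi> (xs[l := A (xs ! l)])) = (\<Sum>l\<in>{i, j}. \<phi> (xs[l := A (xs ! l)]))"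
    proof (rule sum.mono_neutral_right)
      show "\<forall>l\<in>{..<length xs} - {i, j}. \<phi> (xs[l := A (xs ! l)]) = 0"
      proof
        fix l assume "l \<in> {..<length xs} - {i, j}"
        then show "\<phi> (xs[l := A (xs ! l)]) = 0" using ij by (intro alt[of i j]) auto
      qed
    qed (use ij in auto)
    also have "\<dots> = f v u + f u v" unfolding fi using ij(1) by simp
    also note s
    finally show ?thesis by (simp add: der_act_def)
  qed
  then show ?thesis
    using multilinear_der_act[OF A m] by (auto simp: Lam_def)
qed

context compact_simple
begin

lemma Lam_gact: "\<phi> \<in> Lam k \<Longrightarrow> gact br X \<phi> \<in> Lam k"
  unfolding gact_def by (rule Lam_der_act[OF br_lin_r])

lemma gact_2: "gact br X \<phi> [y, z] = - \<phi> [br X y, z] - \<phi> [y, br X z]"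
  by (simp add: gact_def fapply)

lemma gact_3: "gact br X \<phi> [x, y, z] = - \<phi> [br X x, y, z] - \<phi> [x, br X y, z] - \<phi> [x, y, br X z]"
  by (simp add: gact_def fapply)

lemma gact_4: "gact br X \<phi> [w, x, y, z] = - \<phi> [br X w, x, y, z] - \<phi> [w, br X x, y, z]
    - \<phi> [w, x, br X y, z] - \<phi> [w, x, y, br X z]"
  by (simp add: gact_def fapply)

lemma interior_gact: "interior x (gact br X \<phi>) = gact br X (interior x \<phi>) - interior (br X x) \<phi>"
  unfolding gact_def by (rule interior_der_act)

lemma multilinear_interior: "multilinear_form 3 T \<Longrightarrow> multilinear_form 2 (interior x T)"
  using multilinear_form_Suc[of 2 T] by (simp add: numeral_eq_Suc)

lemma ipf_2: "ipf br 2 \<phi> \<psi> = (\<Sum>a\<in>onb br. \<Sum>b\<in>onb br. \<phi> [a, b] * \<psi> [a, b])"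
  by (simp add: numeral_2_eq_2 ipf_Suc ipf_0 fapply)

lemma ipf_3: "ipf br 3 \<phi> \<psi> =
    (\<Sum>a\<in>onb br. \<Sum>b\<in>onb br. \<Sum>c\<in>onb br. \<phi> [a, b, c] * \<psi> [a, b, c])"
  by (simp add: numeral_3_eq_3 ipf_Suc ipf_0 fapply)

subsection \<open>The operators \<open>D\<^sub>+\<close> and \<open>D\<^sub>-\<close>\<close>

text \<open>Twice the map from \<open>\<Lambda>^2 g\<close> to \<open>g\<close> that sends a wedge
  product to the bracket, the 2 coming from ordered pairs. It is also the adjoint of the
  differential on 1-forms for \<open>ipf\<close>, so \<open>gperp br\<close> consists of the
  coclosed 2-forms.\<close>

definition contraction :: "'g form \<Rightarrow> 'g" where
  "contraction \<tau> = (\<Sum>a\<in>onb br. \<Sum>b\<in>onb br. \<tau> [a, b] *\<^sub>R br a b)"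

lemma contraction_add: "contraction (\<tau> + \<sigma>) = contraction \<tau> + contraction \<sigma>"
  and contraction_diff: "contraction (\<tau> - \<sigma>) = contraction \<tau> - contraction \<sigma>"
  and contraction_scale: "contraction (fscale c \<tau>) = c *\<^sub>R contraction \<tau>"
  and contraction_0: "contraction 0 = 0"
  by (simp_all add: contraction_def fapply scaleR_add_left scaleR_diff_left sum.distrib sum_subtractf
      scaleR_sum_right)

text \<open>Apply \<open>contract_inv\<close> to each of the two summation indices, then recombine
  by the derivation rule for the bracket.\<close>

lemma contraction_gact:
  assumes \<tau>: "multilinear_form 2 \<tau>"
  shows "contraction (gact br X \<tau>) = br X (contraction \<tau>)"
proof -
  note l = multilinear_2_linear[OF \<tau>]
  have b1: "bilinear (\<lambda>u v. \<tau> [u, b] *\<^sub>R br v b)" and b2: "bilinear (\<lambda>u v. \<tau> [b, u] *\<^sub>R br b v)" for b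
    unfolding bilinear_def using l[of b]
    by (auto intro!: linearI simp: multilinear_2_simps[OF \<tau>] scaleR_add_left scaleR_add_right mult.commute)
  have "contraction (gact br X \<tau>) =
     - (\<Sum>a\<in>onb br. \<Sum>b\<in>onb br. \<tau> [br X a, b] *\<^sub>R br a b) - (\<Sum>a\<in>onb br. \<Sum>b\<in>onb br. \<tau> [a, br X b] *\<^sub>R br a b)"
    by (simp add: contraction_def gact_2 scaleR_diff_left sum_subtractf sum_negf)
  also have "(\<Sum>a\<in>onb br. \<Sum>b\<in>onb br. \<tau> [br X a, b] *\<^sub>R br a b)
      = (\<Sum>b\<in>onb br. \<Sum>a\<in>onb br. \<tau> [br X a, b] *\<^sub>R br a b)" by (rule sum.swap)
  also have "\<dots> = - (\<Sum>b\<in>onb br. \<Sum>a\<in>onb br. \<tau> [a, b] *\<^sub>R br (br X a) b)"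
    using contract_inv[OF b1] by (simp add: sum_negf)
  also have "(\<Sum>b\<in>onb br. \<Sum>a\<in>onb br. \<tau> [a, b] *\<^sub>R br (br X a) b)
      = (\<Sum>a\<in>onb br. \<Sum>b\<in>onb br. \<tau> [a, b] *\<^sub>R br (br X a) b)" by (rule sum.swap)
  also have "(\<Sum>a\<in>onb br. \<Sum>b\<in>onb br. \<tau> [a, br X b] *\<^sub>R br a b)
      = - (\<Sum>a\<in>onb br. \<Sum>b\<in>onb br. \<tau> [a, b] *\<^sub>R br a (br X b))"
    using contract_inv[OF b2] by (simp add: sum_negf)
  finally show ?thesis
    by (simp add: contraction_def br_sum br_der[of X] scaleR_add_right sum.distrib)
qed

lemma gperp_iff: "\<tau> \<in> gperp br \<longleftrightarrow> \<tau> \<in> Lam 2 \<and> contraction \<tau> = 0"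
  by (simp add: gperp_def contraction_def)

lemma gperp_submodule: "submodule br (gperp br) (gperp br)"
proof -
  have "fvs.subspace (gperp br)"
    using fvs.subspace_0[OF subspace_Lam] fvs.subspace_add[OF subspace_Lam] fvs.subspace_scale[OF subspace_Lam]
    by (intro fvs.subspaceI) (auto simp: gperp_iff contraction_add contraction_scale contraction_0)
  then show ?thesis
    using Lam_gact contraction_gact[OF Lam_multilinear] by (auto simp: submodule_iff gperp_iff)
qed

lemma TT_iff: "T \<in> TT br \<longleftrightarrow> multilinear_form 3 T \<and> (\<forall>x. interior x T \<in> gperp br)"
  by (simp add: TT_def interior_def)

lemma TT_I:
  assumes m: "multilinear_form 3 T" and "\<And>x y. T [x, y, y] = 0" and "\<And>x. contraction (interior x T) = 0"
  shows "T \<in> TT br"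
  using assms multilinear_interior[OF m] by (simp add: TT_iff gperp_iff Lam_2_iff fapply)

lemma TT_multilinear: "T \<in> TT br \<Longrightarrow> multilinear_form 3 T"
  by (simp add: TT_iff)

lemma TT_submodule: "submodule br (TT br) (TT br)"
proof -
  have g: "fvs.subspace (gperp br)" "\<And>X u. u \<in> gperp br \<Longrightarrow> gact br X u \<in> gperp br"
    using gperp_submodule by (auto simp: submodule_iff)
  have m: "multilinear_form 3 0" "multilinear_form 3 \<phi> \<Longrightarrow> multilinear_form 3 \<psi> \<Longrightarrow> multilinear_form 3 (\<phi> + \<psi>)"
    "multilinear_form 3 \<phi> \<Longrightarrow> multilinear_form 3 (fscale c \<phi>)" for \<phi> \<psi> :: "'g form" and c
    using subspace_multilinear[of 3] by (auto simp: fvs.subspace_def)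
  have "fvs.subspace (TT br)"
    using m fvs.subspace_0[OF g(1)] fvs.subspace_add[OF g(1)] fvs.subspace_scale[OF g(1)]
    by (intro fvs.subspaceI) (auto simp: TT_iff interior_add interior_scale interior_zero)
  moreover have "gact br X T \<in> TT br" if "T \<in> TT br" for X T
    using that multilinear_gact g(2) fvs.subspace_diff[OF g(1)] by (auto simp: TT_iff interior_gact)
  ultimately show ?thesis by (auto simp: submodule_iff)
qed

text \<open>The value of \<open>\<rho>\<^sub>*(T(w,-,-))(\<omega>)\<close> at \<open>(x, y, z)\<close>, see \<open>rho_omega_3\<close> below.\<close>
definition cyc :: "'g form \<Rightarrow> 'g \<Rightarrow> 'g \<Rightarrow> 'g \<Rightarrow> 'g \<Rightarrow> real" where
  "cyc T w x y z = T [w, x, br y z] + T [w, y, br z x] + T [w, z, br x y]"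

text \<open>Cyclicity of the triple product brings the endomorphism to the first slot of
  \<open>omega br\<close>, where it pairs to \<tau>. The sign in \<open>der_act\<close> cancels the
  one relating \<open>omega\<close> to \<open>kip\<close>.\<close>

lemma rho_omega_3:
  assumes \<tau>: "multilinear_form 2 \<tau>"
  shows "rho br \<tau> (omega br) [x, y, z] = \<tau> [x, br y z] + \<tau> [y, br z x] + \<tau> [z, br x y]"
proof -
  have A: "kip br (so_of br \<tau> u) v = \<tau> [u, v]" for u v
    using linear_expand'(4)[OF multilinear_2_linear(2)[OF \<tau>], of u v]
    by (simp add: so_of_def kip.Q_simps(7))
  have om: "omega br [u, v, w] = - kip br u (br v w)" for u v w
    by (simp add: omega_def kip_def)
  have "omega br [so_of br \<tau> x, y, z] = - \<tau> [x, br y z]" by (simp add: om A)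
  moreover have "omega br [x, so_of br \<tau> y, z] = - \<tau> [y, br z x]"
    unfolding om kip_cyclic[of x] A ..
  moreover have "omega br [x, y, so_of br \<tau> z] = - \<tau> [z, br x y]"
    unfolding om kip_cyclic[of x] kip_cyclic[of y] A ..
  ultimately show ?thesis by (simp add: rho_def fapply)
qed

lemma omega_length: "length xs \<noteq> 3 \<Longrightarrow> omega br xs = 0"
  by (auto simp: omega_def split: list.split)

lemma rho_omega_length: "length xs \<noteq> 3 \<Longrightarrow> rho br \<tau> (omega br) xs = 0"
  by (simp add: rho_def der_act_def omega_length)

lemma D_minus_2:
  assumes T: "multilinear_form 3 T"
  shows "D_minus br T [y, z] = (\<Sum>a\<in>onb br. cyc T a a y z)"
  using rho_omega_3[OF multilinear_interior[OF T]]
  by (simp add: D_minus_def cyc_def fapply interior_def)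

lemma D_minus_length: "length xs \<noteq> 2 \<Longrightarrow> D_minus br T xs = 0"
  by (simp add: D_minus_def fapply rho_omega_length)

text \<open>The wedge factor contributes \<open>kip br a u\<close>, and summation over the basis
  then puts \<open>u\<close> into the first slot of \<open>T\<close>.\<close>

lemma D_plus_4:
  assumes T: "multilinear_form 3 T"
  shows "D_plus br T [w, x, y, z] = cyc T w x y z - cyc T x w y z + cyc T y w x z - cyc T z w x y"
proof -
  have lin: "linear (\<lambda>a. cyc T a u v t)" for u v t
    unfolding cyc_def by (intro linearI) (simp_all add: multilinear_3_simps[OF T] algebra_simps)
  have "wedge_l (flat br a) (rho br (\<lambda>ys. T (a # ys)) (omega br)) [w, x, y, z] =
     kip br a w * cyc T a x y z - kip br a x * cyc T a w y z + kip br a y * cyc T a w x z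
      - kip br a z * cyc T a w x y" for a
    using rho_omega_3[OF multilinear_interior[OF T, of a]]
    by (simp add: wedge_l_def flat_def del_nth_def cyc_def interior_def numeral_eq_Suc)
  then show ?thesis
    by (simp add: D_plus_def sum.distrib sum_subtractf linear_expand'[OF lin])
qed

lemma D_plus_length: "length xs \<noteq> 4 \<Longrightarrow> D_plus br T xs = 0"
proof -
  assume "length xs \<noteq> 4"
  then have "length (del_nth i xs) \<noteq> 3" if "i < length xs" for i
    using that by (auto simp: del_nth_def)
  then show ?thesis by (simp add: D_plus_def wedge_l_def rho_omega_length)
qed

lemma cyc_add: "cyc (T + S) w x y z = cyc T w x y z + cyc S w x y z"
  and cyc_scale: "cyc (fscale c T) w x y z = c * cyc T w x y z"
  by (simp_all add: cyc_def fapply algebra_simps)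

text \<open>Alternation in the last three arguments comes from skewness of the bracket.\<close>

lemma cyc_skew:
  assumes T: "multilinear_form 3 T"
  shows "cyc T w y x z = - cyc T w x y z" "cyc T w x z y = - cyc T w x y z"
    "cyc T w x x z = 0" "cyc T w x z x = 0" "cyc T w z x x = 0"
  by (simp_all add: cyc_def multilinear_3_simps[OF T] br_skew[of y x] br_skew[of z x] br_skew[of z y])

lemma D_minus_Lam:
  assumes T: "multilinear_form 3 T" shows "D_minus br T \<in> Lam 2"
  unfolding Lam_2_iff
proof (intro conjI allI)
  show "multilinear_form 2 (D_minus br T)"
    by (rule multilinear_form_2I[OF D_minus_length])
      (simp_all add: D_minus_2[OF T] cyc_def linear_iff multilinear_3_simps[OF T] algebra_simps
        sum.distrib sum_distrib_left)
qed (simp add: D_minus_2[OF T] cyc_skew(3-5)[OF T])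

text \<open>With two equal arguments, two of the four terms in \<open>D_plus_4\<close> vanish by
  \<open>cyc_skew\<close>, and the other two cancel after reordering.\<close>

lemma D_plus_Lam:
  assumes T: "multilinear_form 3 T" shows "D_plus br T \<in> Lam 4"
proof (rule Lam_4I)
  show "multilinear_form 4 (D_plus br T)"
    by (rule multilinear_form_4I[OF D_plus_length])
      (simp_all add: D_plus_4[OF T] cyc_def linear_iff multilinear_3_simps[OF T] algebra_simps)
  fix x y z
  show "D_plus br T [x, x, y, z] = 0" "D_plus br T [x, y, x, z] = 0" "D_plus br T [x, y, z, x] = 0"
      "D_plus br T [y, x, x, z] = 0" "D_plus br T [y, x, z, x] = 0" "D_plus br T [y, z, x, x] = 0"
    by (simp_all add: D_plus_4[OF T] cyc_skew(3-5)[OF T]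
        cyc_skew(1)[OF T, where w = x and y = y and x = x and z = z]
        cyc_skew(2)[OF T, where w = x and x = y and z = z and y = x])
qed

lemma cyc_gact:
  assumes T: "multilinear_form 3 T"
  shows "cyc (gact br X T) w x y z =
    - cyc T (br X w) x y z - cyc T w (br X x) y z - cyc T w x (br X y) z - cyc T w x y (br X z)"
  by (simp add: cyc_def gact_3 br_der[of X] multilinear_3_simps[OF T])

lemma D_plus_gact:
  assumes T: "multilinear_form 3 T"
  shows "D_plus br (gact br X T) = gact br X (D_plus br T)"
proof (rule form_eqI)
  show "multilinear_form 4 (D_plus br (gact br X T))"
    by (intro Lam_multilinear D_plus_Lam multilinear_gact T)
  show "multilinear_form 4 (gact br X (D_plus br T))"
    by (intro multilinear_gact Lam_multilinear D_plus_Lam T)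
  fix xs :: "'g list" assume "length xs = 4"
  then show "D_plus br (gact br X T) xs = gact br X (D_plus br T) xs"
    by (elim length4E) (simp add: gact_4 D_plus_4[OF T] D_plus_4[OF multilinear_gact[OF T]] cyc_gact[OF T])
qed

text \<open>The terms in which \<open>X\<close> acts on the two contracted slots cancel by
  \<open>contract_inv\<close>; the others form the action on the result.\<close>

lemma D_minus_gact:
  assumes T: "multilinear_form 3 T"
  shows "D_minus br (gact br X T) = gact br X (D_minus br T)"
proof (rule form_eqI)
  show "multilinear_form 2 (D_minus br (gact br X T))"
    by (intro Lam_multilinear D_minus_Lam multilinear_gact T)
  show "multilinear_form 2 (gact br X (D_minus br T))"
    by (intro multilinear_gact Lam_multilinear D_minus_Lam T)
  fix xs :: "'g list" assume "length xs = 2"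
  then obtain y z where xs: "xs = [y, z]" by (rule length2E)
  have "bilinear (\<lambda>u v. cyc T u v y z)"
    unfolding bilinear_def
    by (auto simp: cyc_def linear_iff multilinear_3_simps[OF T] algebra_simps)
  from contract_inv[OF this, of X] show "D_minus br (gact br X T) xs = gact br X (D_minus br T) xs"
    by (simp add: xs gact_2 D_minus_2[OF T] D_minus_2[OF multilinear_gact[OF T]] cyc_gact[OF T]
        sum_subtractf sum_negf)
qed

lemma D_minus_add:
  assumes "multilinear_form 3 T" "multilinear_form 3 S"
  shows "D_minus br (T + S) = D_minus br T + D_minus br S"
proof (rule form_eqI[of 2])
  have TS: "multilinear_form 3 (T + S)" using assms subspace_multilinear[of 3] by (auto simp: fvs.subspace_def)
  show "multilinear_form 2 (D_minus br (T + S))" by (intro Lam_multilinear D_minus_Lam TS)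
  show "multilinear_form 2 (D_minus br T + D_minus br S)"
    by (intro Lam_multilinear fvs.subspace_add[OF subspace_Lam] D_minus_Lam assms)
  fix xs :: "'g list" assume "length xs = 2"
  then show "D_minus br (T + S) xs = (D_minus br T + D_minus br S) xs"
    by (elim length2E) (simp add: D_minus_2 assms TS fapply cyc_add sum.distrib)
qed

lemma D_minus_scale:
  assumes "multilinear_form 3 T"
  shows "D_minus br (fscale c T) = fscale c (D_minus br T)"
proof (rule form_eqI[of 2])
  have cT: "multilinear_form 3 (fscale c T)" using assms subspace_multilinear[of 3] by (auto simp: fvs.subspace_def)
  show "multilinear_form 2 (D_minus br (fscale c T))" by (intro Lam_multilinear D_minus_Lam cT)
  show "multilinear_form 2 (fscale c (D_minus br T))"
    by (intro Lam_multilinear fvs.subspace_scale[OF subspace_Lam] D_minus_Lam assms)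
  fix xs :: "'g list" assume "length xs = 2"
  then show "D_minus br (fscale c T) xs = fscale c (D_minus br T) xs"
    by (elim length2E) (simp add: D_minus_2 assms cT fapply cyc_scale sum_distrib_left)
qed

lemma D_plus_add:
  assumes "multilinear_form 3 T" "multilinear_form 3 S"
  shows "D_plus br (T + S) = D_plus br T + D_plus br S"
proof (rule form_eqI[of 4])
  have TS: "multilinear_form 3 (T + S)" using assms subspace_multilinear[of 3] by (auto simp: fvs.subspace_def)
  show "multilinear_form 4 (D_plus br (T + S))" by (intro Lam_multilinear D_plus_Lam TS)
  show "multilinear_form 4 (D_plus br T + D_plus br S)"
    by (intro Lam_multilinear fvs.subspace_add[OF subspace_Lam] D_plus_Lam assms)
  fix xs :: "'g list" assume "length xs = 4"
  then show "D_plus br (T + S) xs = (D_plus br T + D_plus br S) xs"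
    by (elim length4E) (simp add: D_plus_4 assms TS fapply cyc_add)
qed

lemma D_plus_scale:
  assumes "multilinear_form 3 T"
  shows "D_plus br (fscale c T) = fscale c (D_plus br T)"
proof (rule form_eqI[of 4])
  have cT: "multilinear_form 3 (fscale c T)" using assms subspace_multilinear[of 3] by (auto simp: fvs.subspace_def)
  show "multilinear_form 4 (D_plus br (fscale c T))" by (intro Lam_multilinear D_plus_Lam cT)
  show "multilinear_form 4 (fscale c (D_plus br T))"
    by (intro Lam_multilinear fvs.subspace_scale[OF subspace_Lam] D_plus_Lam assms)
  fix xs :: "'g list" assume "length xs = 4"
  then show "D_plus br (fscale c T) xs = fscale c (D_plus br T) xs"
    by (elim length4E) (simp add: D_plus_4 assms cT fapply cyc_scale algebra_simps)
qed

lemma module_hom_D_plus: "module_hom_on br (Collect (multilinear_form 3)) (D_plus br)"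
  by (simp add: module_hom_on_def D_plus_add D_plus_scale D_plus_gact)

lemma module_hom_D_minus: "module_hom_on br (Collect (multilinear_form 3)) (D_minus br)"
  by (simp add: module_hom_on_def D_minus_add D_minus_scale D_minus_gact)

subsection \<open>The submodules of \<open>g \<otimes> g\<^sup>\<bottom>\<close>\<close>

lemma kernel_submodule:
  assumes S: "submodule br S S" and h: "module_hom_on br S h"
  shows "submodule br S {x \<in> S. h x = 0}" (is "submodule br S ?K")
proof -
  have sub: "fvs.subspace S" and g: "\<And>X u. u \<in> S \<Longrightarrow> gact br X u \<in> S"
    using S by (auto simp: submodule_iff)
  have "fvs.subspace ?K"
    using fvs.subspace_0[OF sub] fvs.subspace_add[OF sub] fvs.subspace_scale[OF sub]
      module_hom_on_0[OF h] module_hom_onD[OF h]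
    by (intro fvs.subspaceI) auto
  then show ?thesis using g module_hom_onD(3)[OF h] by (auto simp: submodule_iff)
qed

lemma TT_hom:
  "module_hom_on br (TT br) (D_plus br)" "module_hom_on br (TT br) (D_minus br)"
  using module_hom_on_subset[OF module_hom_D_plus] module_hom_on_subset[OF module_hom_D_minus]
    TT_multilinear by auto

lemma ker_on_submodule:
  assumes "module_hom_on br (TT br) D"
  shows "submodule br (TT br) (ker_on (TT br) D)" "submodule br (ker_on (TT br) D) (ker_on (TT br) D)"
  using kernel_submodule[OF TT_submodule assms] by (auto simp: ker_on_def zero_form_eq submodule_iff)

lemma W_har_eq: "W_har br = ker_on (TT br) (D_plus br) \<inter> ker_on (TT br) (D_minus br)"
  by (auto simp: W_har_def ker_on_def)

lemma W_har_submodule: "submodule br (TT br) (W_har br)"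
  using ker_on_submodule(1)[OF TT_hom(1)] ker_on_submodule(1)[OF TT_hom(2)] fvs.subspace_inter
  by (auto simp: W_har_eq submodule_iff)

text \<open>The common pattern of claims (2) and (3), with the two operators in either order. A
  family in the kernel of \<open>D\<close> on which \<open>D'\<close> is injective meets
  \<open>W_har br\<close> only in zero, so \<open>orthogonal_lift\<close> applies.\<close>

lemma W_har_perp_lift:
  assumes D: "D = D_plus br \<and> D' = D_minus br \<or> D = D_minus br \<and> D' = D_plus br"
    and S: "submodule br S S" and h: "module_hom_on br S h"
    and hT: "\<And>s. s \<in> S \<Longrightarrow> h s \<in> TT br" and hD: "\<And>s. s \<in> S \<Longrightarrow> D (h s) = 0"
    and hD': "\<And>s. s \<in> S \<Longrightarrow> D' (h s) = 0 \<Longrightarrow> s = 0"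
  shows "\<exists>U. submodule br (W_har_perp br D) U \<and> module_iso br U S"
  unfolding W_har_perp_def
proof (rule orthogonal_lift[OF _ _ _ S h])
  have hom: "module_hom_on br (TT br) D" using D TT_hom by auto
  show "submodule br (ker_on (TT br) D) (ker_on (TT br) D)" by (rule ker_on_submodule(2)[OF hom])
  have "W_har br \<subseteq> ker_on (TT br) D" using D W_har_eq by auto
  then show "submodule br (ker_on (TT br) D) (W_har br)"
    using W_har_submodule by (auto simp: submodule_iff)
  show "multilinear_form 3 \<phi>" if "\<phi> \<in> ker_on (TT br) D" for \<phi>
    using that TT_multilinear by (auto simp: ker_on_def)
  show "h s \<in> ker_on (TT br) D" if "s \<in> S" for s
    using hT[OF that] hD[OF that] by (simp add: ker_on_def zero_form_eq)
  show "s = 0" if "s \<in> S" "h s \<in> W_har br" for s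
    using hD'[OF that(1)] that(2) D by (auto simp: W_har_def zero_form_eq)
qed

lemma ipf_sum_l: "ipf br k (\<Sum>i\<in>I. f i) \<psi> = (\<Sum>i\<in>I. ipf br k (f i) \<psi>)"
  by (induction I rule: infinite_finite_induct) (auto simp: ipf_zero_l ipf_add_l)

text \<open>The two summands are supported on lists of length 2 and 4 respectively, so forms of
  different degree add up without interference.\<close>

lemma D_both_eq_0:
  assumes "D_minus br T + D_plus br T = 0"
  shows "D_minus br T = 0" "D_plus br T = 0"
proof -
  have s: "D_minus br T xs + D_plus br T xs = 0" for xs
    using fun_cong[OF assms, of xs] by (simp add: fapply)
  have "D_minus br T xs = 0 \<and> D_plus br T xs = 0" for xs
    using s[of xs] D_minus_length[of xs T] D_plus_length[of xs T] by (cases "length xs = 2") auto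
  then show "D_minus br T = 0" "D_plus br T = 0" by (auto simp: fun_eq_iff zero_fun_apply)
qed

lemma TT_decomposition:
  "\<exists>(m::nat) (V :: nat \<Rightarrow> 'g form set).
        (\<forall>i<m. V i \<subseteq> TT br \<and> irreducible_module br (V i) \<and>
           (\<exists>U. U \<subseteq> Lam2_plus_Lam4 \<and> irreducible_module br U \<and> module_iso br (V i) U)) \<and>
        (\<forall>T\<in>TT br. \<exists>w\<in>W_har br. \<exists>v. (\<forall>i<m. v i \<in> V i) \<and>
           T = (\<lambda>xs. w xs + (\<Sum>i<m. v i xs))) \<and>
        (\<forall>w\<in>W_har br. \<forall>v. (\<forall>i<m. v i \<in> V i) \<and> (\<lambda>xs. w xs + (\<Sum>i<m. v i xs)) = zero_form
           \<longrightarrow> w = zero_form \<and> (\<forall>i<m. v i = zero_form))"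
proof -
  define M where "M = {x \<in> TT br. \<forall>w\<in>W_har br. ipf br 3 x w = 0}"
  have MT: "submodule br (TT br) M"
    unfolding M_def by (rule orth_complement_submodule[OF TT_submodule W_har_submodule TT_multilinear])
  then have MM: "submodule br M M" and Ms: "fvs.subspace M" by (auto simp: submodule_iff)
  have Mm: "M \<subseteq> Collect (multilinear_form 3)" using TT_multilinear by (auto simp: M_def)
  obtain m :: nat and V where
    V: "\<forall>i<m. irreducible_module br (V i) \<and> V i \<subseteq> M"
    and orth: "\<forall>i<m. \<forall>j<m. i \<noteq> j \<longrightarrow> (\<forall>x\<in>V i. \<forall>y\<in>V j. ipf br 3 x y = 0)"
    and dec: "\<forall>T\<in>M. \<exists>v. (\<forall>i<m. v i \<in> V i) \<and> T = (\<Sum>i<m. v i)"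
    using orthogonal_decomposition[OF MM Mm] by (elim exE conjE) rule
  \<comment> \<open>On \<open>TT br\<close> the kernel of \<open>h\<close> is
    \<open>W_har br\<close>, by \<open>D_both_eq_0\<close>; hence \<open>h\<close> is injective on
    \<open>M\<close> and carries each \<open>V i\<close> isomorphically to a submodule of
    \<open>Lam2_plus_Lam4\<close>.\<close>
  define h where "h T = D_minus br T + D_plus br T" for T
  have h: "module_hom_on br (TT br) h"
    unfolding module_hom_on_def h_def
    using module_hom_onD[OF TT_hom(1)] module_hom_onD[OF TT_hom(2)]
    by (simp add: gact_add fvs.scale_right_distrib)
  have ker: "T = 0" if "T \<in> M" "h T = 0" for T
  proof -
    have "T \<in> W_har br"
      using D_both_eq_0[of T] that by (simp add: h_def W_har_def M_def zero_form_eq)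
    then have "ipf br 3 T T = 0" using that by (simp add: M_def)
    then show ?thesis using ipf_definite that Mm by blast
  qed
  have "inj_on h M"
    by (rule module_hom_on_inj[OF module_hom_on_subset[OF h] Ms ker]) (auto simp: M_def)
  then have inj: "inj_on h (V i)" if "i < m" for i using V that inj_on_subset by blast
  have hV: "module_hom_on br (V i) h" if "i < m" for i
    using V that by (intro module_hom_on_subset[OF h]) (auto simp: M_def)
  have hL: "h T \<in> Lam2_plus_Lam4" if "T \<in> M" for T
  proof -
    have "multilinear_form 3 T" using that Mm by blast
    then show ?thesis
      unfolding Lam2_plus_Lam4_def fadd_eq h_def using D_minus_Lam D_plus_Lam by blast
  qed
  have c1: "V i \<subseteq> TT br \<and> irreducible_module br (V i) \<and>
      (\<exists>U. U \<subseteq> Lam2_plus_Lam4 \<and> irreducible_module br U \<and> module_iso br (V i) U)" if i: "i < m" for i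
  proof (intro conjI exI[of _ "h ` V i"])
    show "V i \<subseteq> TT br" "irreducible_module br (V i)" using V i by (auto simp: M_def)
    then show "irreducible_module br (h ` V i)" using irreducible_image hV[OF i] inj[OF i] by blast
    show "module_iso br (V i) (h ` V i)" by (rule module_iso_image[OF hV[OF i] inj[OF i]])
    show "h ` V i \<subseteq> Lam2_plus_Lam4" using V i hL by blast
  qed
  have fsum: "(\<lambda>xs. w xs + (\<Sum>i<m. v i xs)) = w + (\<Sum>i<m. v i)" for w and v :: "nat \<Rightarrow> 'g form"
    by (simp add: fun_eq_iff fapply sum_apply)
  have Ws: "fvs.subspace (W_har br)" and WT: "W_har br \<subseteq> TT br"
    using W_har_submodule by (auto simp: submodule_iff)
  have Wm: "multilinear_form 3 \<phi>" if "\<phi> \<in> W_har br" for \<phi> using that WT TT_multilinear by blast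
  have c2: "\<exists>w\<in>W_har br. \<exists>v. (\<forall>i<m. v i \<in> V i) \<and> T = w + (\<Sum>i<m. v i)" if T: "T \<in> TT br" for T
  proof -
    obtain w where w: "w \<in> W_har br" "\<And>u. u \<in> W_har br \<Longrightarrow> ipf br 3 (T - w) u = 0"
      using projection[OF Ws Wm] by blast
    have "fvs.subspace (TT br)" using TT_submodule by (simp add: submodule_iff)
    then have "T - w \<in> TT br" using w(1) T WT by (intro fvs.subspace_diff) auto
    then have "T - w \<in> M" using w(2) by (simp add: M_def)
    then obtain v where v: "\<forall>i<m. v i \<in> V i" "T - w = (\<Sum>i<m. v i)" using dec by blast
    have "T = w + (\<Sum>i<m. v i)" by (simp add: v(2)[symmetric])
    then show ?thesis using w(1) v(1) by blast
  qed
  \<comment> \<open>Pairing the relation with \<open>w\<close> removes all \<open>v i\<close>, since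
    they lie in the complement \<open>M\<close>; pairing what remains with \<open>v j\<close>
    isolates that component by mutual orthogonality.\<close>
  have c3: "w = 0 \<and> (\<forall>i<m. v i = 0)" if w: "w \<in> W_har br" and v: "\<forall>i<m. v i \<in> V i"
      and s: "w + (\<Sum>i<m. v i) = 0" for w v
  proof -
    have vM: "v i \<in> M" if "i < m" for i using v V that by blast
    have "ipf br 3 (w + (\<Sum>i<m. v i)) w = ipf br 3 w w + (\<Sum>i<m. ipf br 3 (v i) w)"
      by (simp add: ipf_add_l ipf_sum_l)
    also have "(\<Sum>i<m. ipf br 3 (v i) w) = 0"
      using vM w by (intro sum.neutral) (auto simp: M_def)
    finally have "ipf br 3 w w = 0" by (simp add: s ipf_zero_l)
    then have w0: "w = 0" using ipf_definite[OF Wm[OF w]] by simp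
    have "v j = 0" if j: "j < m" for j
    proof -
      have "0 = ipf br 3 (\<Sum>i<m. v i) (v j)" using s w0 by (simp add: ipf_zero_l)
      also have "\<dots> = (\<Sum>i<m. if i = j then ipf br 3 (v j) (v j) else 0)"
        unfolding ipf_sum_l using orth v j by (intro sum.cong) auto
      finally have "ipf br 3 (v j) (v j) = 0" using j by simp
      then show ?thesis using ipf_definite vM[OF j] Mm by blast
    qed
    then show ?thesis using w0 by blast
  qed
  show ?thesis
    unfolding zero_form_eq
  proof (rule exI[of _ m], rule exI[of _ V], intro conjI)
    show "\<forall>i<m. V i \<subseteq> TT br \<and> irreducible_module br (V i) \<and>
        (\<exists>U. U \<subseteq> Lam2_plus_Lam4 \<and> irreducible_module br U \<and> module_iso br (V i) U)"
      by (intro allI impI c1)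
    show "\<forall>T\<in>TT br. \<exists>w\<in>W_har br. \<exists>v. (\<forall>i<m. v i \<in> V i) \<and> T = (\<lambda>xs. w xs + (\<Sum>i<m. v i xs))"
    proof
      fix T assume "T \<in> TT br"
      then obtain w v where "w \<in> W_har br" "\<forall>i<m. v i \<in> V i" "T = w + (\<Sum>i<m. v i)"
        using c2 by blast
      then show "\<exists>w\<in>W_har br. \<exists>v. (\<forall>i<m. v i \<in> V i) \<and> T = (\<lambda>xs. w xs + (\<Sum>i<m. v i xs))"
        by (intro bexI[of _ w] exI[of _ v] conjI trans[OF _ fsum[symmetric]])
    qed
    show "\<forall>w\<in>W_har br. \<forall>v. (\<forall>i<m. v i \<in> V i) \<and> (\<lambda>xs. w xs + (\<Sum>i<m. v i xs)) = 0
        \<longrightarrow> w = 0 \<and> (\<forall>i<m. v i = 0)"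
    proof (intro ballI allI impI, elim conjE)
      fix w v assume "w \<in> W_har br" "\<forall>i<m. v i \<in> V i" "(\<lambda>xs. w xs + (\<Sum>i<m. v i xs)) = 0"
      then show "w = 0 \<and> (\<forall>i<m. v i = 0)" using fsum[of w v] by (intro c3) simp_all
    qed
  qed
qed

text \<open>The Jacobi identity oriented for rewriting. Instances with letters in alphabetical order
  eliminate the double brackets whose outer letter comes first.\<close>

lemma jacobi_sort: "br w (br y z) = br y (br w z) - br z (br w y)"
  using br_der[of w y z] br_skew[of "br w y" z] by simp

section \<open>The Casimir operator on 2-forms and the submodule isomorphic to
  \<open>gperp br\<close>\<close>

definition casimir_form :: "'g form \<Rightarrow> 'g form" where
  "casimir_form \<sigma> = (\<Sum>a\<in>onb br. gact br a (gact br a \<sigma>))"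

lemma casimir_form_2: "casimir_form \<sigma> [y, z] = (\<Sum>a\<in>onb br. \<sigma> [br a (br a y), z] + 2 * \<sigma> [br a y, br a z]
    + \<sigma> [y, br a (br a z)])"
  by (simp add: casimir_form_def sum_apply gact_2 algebra_simps)

text \<open>The trilinear function \<open>f\<close> is skew in its first two arguments and, by
  invariance, symmetric in its last two, which forces it to vanish. Since \<open>casimir\<close>
  writes every vector as a sum of brackets, \<sigma> vanishes too.\<close>

lemma invariant_2_form:
  assumes \<sigma>: "\<sigma> \<in> Lam 2" and inv: "\<And>a y z. \<sigma> [br a y, z] + \<sigma> [y, br a z] = 0"
  shows "\<sigma> = 0"
proof (rule form_eqI[of 2])
  note m = Lam_multilinear[OF \<sigma>]
  show "multilinear_form 2 \<sigma>" by (rule m)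
  show "multilinear_form 2 0" using fvs.subspace_0[OF subspace_multilinear] by blast
  define f where "f x y z = \<sigma> [br x y, z]" for x y z
  have f1: "f x y z = - f y x z" for x y z
    by (simp add: f_def br_skew[of x y] multilinear_2_simps[OF m])
  have f2: "f x y z = f x z y" for x y z
    using inv[of x y z] Lam_2_skew[OF \<sigma>, of y "br x z"] by (simp add: f_def)
  have f0: "f x y z = 0" for x y z
    using f1[of x y z] f2[of x y z] f1[of x z y] f2[of z x y] f1[of z y x] f2[of y z x] by simp
  fix xs :: "'g list" assume "length xs = 2"
  then obtain y z where xs: "xs = [y, z]" by (rule length2E)
  have "\<sigma> [y, z] = - \<sigma> [(\<Sum>a\<in>onb br. br a (br a y)), z]"
    by (simp add: casimir multilinear_2_simps[OF m])
  also have "\<dots> = - (\<Sum>a\<in>onb br. f a (br a y) z)"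
    by (simp add: linear_sum[OF multilinear_2_linear(1)[OF m]] f_def)
  finally show "\<sigma> xs = 0 xs" by (simp add: xs f0 zero_fun_apply)
qed

text \<open>The pairing is minus the sum of the squared norms of the derivatives of \<sigma> along
  the basis. If it is zero, \<sigma> is invariant under basis vectors, hence by linearity under all
  of \<open>g\<close>.\<close>

lemma casimir_form_definite:
  assumes \<sigma>: "\<sigma> \<in> Lam 2" and z: "ipf br 2 (casimir_form \<sigma>) \<sigma> = 0"
  shows "\<sigma> = 0"
proof (rule invariant_2_form[OF \<sigma>])
  note m = Lam_multilinear[OF \<sigma>]
  have "ipf br 2 (casimir_form \<sigma>) \<sigma> = - (\<Sum>a\<in>onb br. ipf br 2 (gact br a \<sigma>) (gact br a \<sigma>))"
    unfolding casimir_form_def ipf_sum_l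
    by (simp add: ipf_gact[OF multilinear_gact[OF m] m] sum_negf)
  then have "\<forall>a\<in>onb br. ipf br 2 (gact br a \<sigma>) (gact br a \<sigma>) = 0"
    using z sum_nonneg_eq_0_iff[of "onb br" "\<lambda>a. ipf br 2 (gact br a \<sigma>) (gact br a \<sigma>)"] ipf_nonneg
    by simp
  then have g0: "gact br a \<sigma> = 0" if "a \<in> onb br" for a
    using that ipf_definite[OF multilinear_gact[OF m]] by blast
  fix x y z
  have lin: "linear (\<lambda>x. \<sigma> [br x y, z] + \<sigma> [y, br x z])"
    by (simp add: linear_iff multilinear_2_simps[OF m] algebra_simps)
  have "\<sigma> [br a y, z] + \<sigma> [y, br a z] = 0" if "a \<in> onb br" for a
    using gact_2[of a \<sigma> y z] g0[OF that] by (simp add: zero_fun_apply)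
  then show "\<sigma> [br x y, z] + \<sigma> [y, br x z] = 0"
    using linear_expand'(1)[OF lin, of x] by simp
qed

text \<open>The tensor \<open>\<Sum> e\<^sub>a \<otimes> L\<^sub>a\<sigma>\<close>.\<close>
definition act_form :: "'g form \<Rightarrow> 'g form" where
  "act_form \<sigma> = (\<lambda>xs. case xs of [] \<Rightarrow> 0 | x # ys \<Rightarrow> gact br x \<sigma> ys)"

lemma interior_act_form: "interior x (act_form \<sigma>) = gact br x \<sigma>"
  by (simp add: act_form_def fun_eq_iff fapply)

lemma act_form_3: "act_form \<sigma> [x, y, z] = - \<sigma> [br x y, z] - \<sigma> [y, br x z]"
  by (simp add: act_form_def gact_2)

lemma multilinear_act_form:
  assumes \<sigma>: "multilinear_form 2 \<sigma>" shows "multilinear_form 3 (act_form \<sigma>)"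
proof (rule multilinear_form_3I)
  fix xs :: "'g list" assume "length xs \<noteq> 3"
  then show "act_form \<sigma> xs = 0"
    using multilinear_length[OF multilinear_gact[OF \<sigma>]] by (auto simp: act_form_def split: list.split)
qed (simp_all add: act_form_3 linear_iff multilinear_2_simps[OF \<sigma>] algebra_simps)

lemma act_form_TT: "\<sigma> \<in> gperp br \<Longrightarrow> act_form \<sigma> \<in> TT br"
  using gperp_submodule by (auto simp: TT_iff interior_act_form submodule_iff gperp_iff
      intro: multilinear_act_form Lam_multilinear)

lemma act_form_hom: "module_hom_on br (gperp br) act_form"
  unfolding module_hom_on_def
proof (intro conjI ballI allI)
  show "act_form (\<sigma> + \<tau>) = act_form \<sigma> + act_form \<tau>" for \<sigma> \<tau>
    by (auto simp: act_form_def fun_eq_iff fapply gact_add split: list.split)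
  show "act_form (fscale c \<sigma>) = fscale c (act_form \<sigma>)" for c \<sigma>
    by (auto simp: act_form_def fun_eq_iff fapply gact_scale split: list.split)
  fix X \<sigma> assume "\<sigma> \<in> gperp br"
  then have m: "multilinear_form 2 \<sigma>" by (simp add: gperp_iff Lam_multilinear)
  show "act_form (gact br X \<sigma>) = gact br X (act_form \<sigma>)"
  proof (rule form_eqI)
    show "multilinear_form 3 (act_form (gact br X \<sigma>))" by (intro multilinear_act_form multilinear_gact m)
    show "multilinear_form 3 (gact br X (act_form \<sigma>))" by (intro multilinear_act_form multilinear_gact m)
    fix xs :: "'g list" assume "length xs = 3"
    then show "act_form (gact br X \<sigma>) xs = gact br X (act_form \<sigma>) xs"
      by (elim length3E) (simp add: act_form_3 gact_3 gact_2 br_der[of X] multilinear_2_simps[OF m])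
  qed
qed

text \<open>Conceptually the value is a multiple of \<open>dd\<sigma>\<close>: the differential
  commutes with the action, and summing \<open>e_a \<and> L_a\<close> gives a multiple of the
  differential. The proof expands all terms and cancels them.\<close>

lemma D_plus_act_form:
  assumes \<sigma>: "\<sigma> \<in> Lam 2" shows "D_plus br (act_form \<sigma>) = 0"
proof (rule form_eqI)
  note m = Lam_multilinear[OF \<sigma>]
  note mT = multilinear_act_form[OF m]
  show "multilinear_form 4 (D_plus br (act_form \<sigma>))" by (intro Lam_multilinear D_plus_Lam mT)
  show "multilinear_form 4 0" using fvs.subspace_0[OF subspace_multilinear] by blast
  fix xs :: "'g list" assume "length xs = 4"
  then obtain w x y z where xs: "xs = [w, x, y, z]" by (rule length4E)
  \<comment> \<open>Rewriting to a normal form: letters in single brackets are sorted, double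
    brackets are reduced by Jacobi, and values of \<sigma> on two brackets by skewness.\<close>
  note sk = br_skew[of x w] br_skew[of y w] br_skew[of z w] br_skew[of y x] br_skew[of z x] br_skew[of z y]
  note J = jacobi_sort[of w x y] jacobi_sort[of w x z] jacobi_sort[of w y z] jacobi_sort[of x y z]
  note s = Lam_2_skew[OF \<sigma>, of "br w x" "br y z"] Lam_2_skew[OF \<sigma>, of "br w y" "br x z"]
    Lam_2_skew[OF \<sigma>, of "br w z" "br x y"]
  show "D_plus br (act_form \<sigma>) xs = 0 xs"
    unfolding xs D_plus_4[OF mT] cyc_def act_form_3 zero_fun_apply
    by (simp add: sk J s multilinear_2_simps[OF m])
qed

text \<open>The sum is minus the inner product of the contraction of \<tau> with
  \<open>u\<close>.\<close>

lemma contraction_gperp: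
  assumes "contraction \<tau> = 0" "multilinear_form 2 \<tau>"
  shows "(\<Sum>a\<in>onb br. \<tau> [a, br a u]) = 0"
proof -
  have "(\<Sum>a\<in>onb br. \<tau> [a, br a u]) = (\<Sum>a\<in>onb br. \<Sum>b\<in>onb br. kip br (br a u) b * \<tau> [a, b])"
    by (simp add: linear_expand'(1)[OF multilinear_2_linear(2)[OF assms(2)]])
  also have "\<dots> = - (\<Sum>a\<in>onb br. \<Sum>b\<in>onb br. \<tau> [a, b] * kip br (br a b) u)"
    by (simp add: kip_inv sum_negf[symmetric] kip.sym[of _ u] mult.commute del: sum_negf)
  also have "\<dots> = - kip br (contraction \<tau>) u"
    by (simp add: contraction_def kip.Q_simps(7))
  finally show ?thesis by (simp add: assms)
qed

lemma D_minus_act_form: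
  assumes \<sigma>: "\<sigma> \<in> gperp br" shows "D_minus br (act_form \<sigma>) = casimir_form \<sigma>"
proof (rule form_eqI)
  have L: "\<sigma> \<in> Lam 2" and c: "contraction \<sigma> = 0" using \<sigma> by (auto simp: gperp_iff)
  note m = Lam_multilinear[OF L]
  note mT = multilinear_act_form[OF m]
  show "multilinear_form 2 (D_minus br (act_form \<sigma>))" by (intro Lam_multilinear D_minus_Lam mT)
  show "multilinear_form 2 (casimir_form \<sigma>)"
    unfolding casimir_form_def
    using fvs.subspace_sum[OF subspace_multilinear, of "onb br" "\<lambda>a. gact br a (gact br a \<sigma>)"]
      multilinear_gact m by blast
  fix xs :: "'g list" assume "length xs = 2"
  then obtain y z where xs: "xs = [y, z]" by (rule length2E)
  \<comment> \<open>The first three terms are the summand of the Casimir operator. The remaining one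
    sums to zero by \<open>contraction_gperp\<close>, applied to the vector
    \<open>br y z\<close>.\<close>
  have "cyc (act_form \<sigma>) a a y z = (\<sigma> [br a (br a y), z] + 2 * \<sigma> [br a y, br a z]
    + \<sigma> [y, br a (br a z)]) - \<sigma> [a, br a (br y z)]" for a
    using Lam_2_skew[OF L, of "br a y" "br a z"] Lam_2_skew[OF L, of z "br a (br a y)"]
    by (simp add: cyc_def act_form_3 br_skew[of z a] multilinear_2_simps[OF m])
  then show "D_minus br (act_form \<sigma>) xs = casimir_form \<sigma> xs"
    unfolding xs D_minus_2[OF mT] casimir_form_2
    by (simp only: sum_subtractf contraction_gperp[OF c m] diff_0_right)
qed

lemma W_har_perp_D_plus:
  "\<exists>U. submodule br (W_har_perp br (D_plus br)) U \<and> module_iso br U (gperp br)"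
proof (rule W_har_perp_lift[OF _ gperp_submodule act_form_hom act_form_TT])
  show "D_plus br (act_form s) = 0" if "s \<in> gperp br" for s
    using that D_plus_act_form by (simp add: gperp_iff)
  show "s = 0" if "s \<in> gperp br" "D_minus br (act_form s) = 0" for s
    using that D_minus_act_form[OF that(1)] casimir_form_definite[of s]
    by (simp add: gperp_iff ipf_zero_l)
qed auto

section \<open>The differential on 2- and 3-forms, and the submodule isomorphic to
  \<open>Lam3_delta br\<close>\<close>

lemma dform_2:
  "dform br \<tau> [x, y, z] = \<tau> [br x y, z] - \<tau> [br x z, y] + \<tau> [br y z, x]"
  by (simp add: dform_def del_nth_def numeral_eq_Suc)

lemma dform_3:
  "dform br \<xi> [w, x, y, z] = \<xi> [br w x, y, z] - \<xi> [br w y, x, z] + \<xi> [br w z, x, y]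
     + \<xi> [br x y, w, z] - \<xi> [br x z, w, y] + \<xi> [br y z, w, x]"
  by (simp add: dform_def del_nth_def numeral_eq_Suc)

lemma dform_length:
  assumes "multilinear_form k \<phi>" "length xs \<noteq> Suc k" shows "dform br \<phi> xs = 0"
proof -
  have "\<phi> (br (xs ! i) (xs ! j) # del_nth i (del_nth j xs)) = 0" if "i < j" "j < length xs" for i j
    using that assms(2) by (intro multilinear_length[OF assms(1)]) (auto simp: del_nth_def)
  then show ?thesis unfolding dform_def by (auto intro!: sum.neutral)
qed

lemma dform_Lam_2:
  assumes \<tau>: "\<tau> \<in> Lam 2" shows "dform br \<tau> \<in> Lam 3"
proof (rule Lam_3I)
  note m = Lam_multilinear[OF \<tau>]
  show "multilinear_form 3 (dform br \<tau>)"
    by (rule multilinear_form_3I[OF dform_length[OF m]])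
      (simp_all add: dform_2 linear_iff multilinear_2_simps[OF m] algebra_simps)
  fix x y
  show "dform br \<tau> [x, x, y] = 0" "dform br \<tau> [x, y, x] = 0" "dform br \<tau> [y, x, x] = 0"
    by (simp_all add: dform_2 br_skew[of y x] multilinear_2_simps[OF m])
qed

lemma dform_dform:
  assumes \<tau>: "\<tau> \<in> Lam 2" shows "dform br (dform br \<tau>) [w, x, y, z] = 0"
proof -
  note m = Lam_multilinear[OF \<tau>]
  note s = Lam_2_skew[OF \<tau>, of "br w x" "br y z"] Lam_2_skew[OF \<tau>, of "br w y" "br x z"]
    Lam_2_skew[OF \<tau>, of "br w z" "br x y"]
  note J = br_skew[of "br _ _" w] br_skew[of "br _ _" x] br_skew[of "br _ _" y] br_skew[of "br _ _" z]
    br_skew[of x w] br_skew[of y w] br_skew[of z w] br_skew[of y x] br_skew[of z x] br_skew[of z y]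
    jacobi_sort[of w x y] jacobi_sort[of w x z] jacobi_sort[of w y z] jacobi_sort[of x y z]
  show ?thesis
    unfolding dform_3 dform_2 by (simp add: J s multilinear_2_simps[OF m])
qed

text \<open>The twelve terms of \<open>D_plus\<close> match the six terms of \<open>dform\<close> in
  pairs, because a 3-form is alternating in all its slots; hence the factor 2.\<close>

lemma D_plus_Lam_3:
  assumes \<psi>: "\<psi> \<in> Lam 3" shows "D_plus br \<psi> = fscale 2 (dform br \<psi>)"
proof
  fix xs
  note m = Lam_multilinear[OF \<psi>]
  show "D_plus br \<psi> xs = fscale 2 (dform br \<psi>) xs"
  proof (cases "length xs = 4")
    case True
    then obtain w x y z where xs: "xs = [w, x, y, z]" by (rule length4E)
    have c: "\<psi> [a, b, u] = \<psi> [u, a, b]" for a b u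
      using Lam_3_skew(2)[OF \<psi>, of a u b] Lam_3_skew(1)[OF \<psi>, of u a b] by simp
    note c' = Lam_3_skew(1)[OF \<psi>]
    have b: "br z x = - br x z" "br z w = - br w z" "br y w = - br w y"
      by (rule br_skew)+
    show ?thesis
      unfolding xs fscale_apply dform_3 D_plus_4[OF m] cyc_def b multilinear_3_simps[OF m]
      using c[of w x "br y z"] c[of w y "br x z"] c[of w z "br x y"] c[of x y "br w z"]
        c[of x z "br w y"] c[of y z "br w x"] c'[of x w "br y z"] c'[of y w "br x z"] c'[of z w "br x y"]
        c'[of y x "br w z"] c'[of z x "br w y"] c'[of z y "br w x"]
      by simp
  next
    case False
    then show ?thesis using dform_length[OF m] D_plus_length by (simp add: fscale_apply)
  qed
qed

text \<open>Transfers equivariance and multilinearity from \<open>D_plus\<close> to the differential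
  on 3-forms.\<close>

lemma dform_Lam_3: "\<psi> \<in> Lam 3 \<Longrightarrow> dform br \<psi> = fscale (1/2) (D_plus br \<psi>)"
  by (simp add: D_plus_Lam_3 fun_eq_iff fapply)

lemma dform_gact:
  assumes \<psi>: "\<psi> \<in> Lam 3" shows "dform br (gact br X \<psi>) = gact br X (dform br \<psi>)"
  using dform_Lam_3[OF \<psi>] dform_Lam_3[OF Lam_gact[OF \<psi>]] D_plus_gact[OF Lam_multilinear[OF \<psi>]]
  by (simp add: gact_scale)

lemma dform_Lam_3_multilinear:
  assumes "\<psi> \<in> Lam 3" shows "multilinear_form 4 (dform br \<psi>)"
  unfolding dform_Lam_3[OF assms]
  by (intro Lam_multilinear fvs.subspace_scale[OF subspace_Lam] D_plus_Lam assms)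

text \<open>The codifferential is equivariant, being adjoint to an equivariant map for invariant
  inner products. Concretely, \<open>P\<close> says that \<psi> is the codifferential of \<phi>, and
  the witness \<phi> transforms along with \<psi>.\<close>

lemma Lam3_delta_submodule: "submodule br (Lam3_delta br) (Lam3_delta br)"
proof -
  define P where "P \<psi> \<phi> \<longleftrightarrow> (\<forall>\<xi>\<in>Lam 3. ipf br 3 \<psi> \<xi> = ipf br 4 \<phi> (dform br \<xi>))" for \<psi> \<phi>
  have L: "\<psi> \<in> Lam3_delta br \<longleftrightarrow> \<psi> \<in> Lam 3 \<and> (\<exists>\<phi>\<in>Lam 4. P \<psi> \<phi>)" for \<psi>
    by (simp add: Lam3_delta_def P_def)
  have "fvs.subspace (Lam3_delta br)"
  proof (rule fvs.subspaceI)
    have "P 0 0" by (simp add: P_def ipf_zero_l)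
    then show "0 \<in> Lam3_delta br" using fvs.subspace_0[OF subspace_Lam] L by blast
    have "P (\<psi> + \<psi>') (\<phi> + \<phi>')" if "P \<psi> \<phi>" "P \<psi>' \<phi>'" for \<psi> \<psi>' \<phi> \<phi>'
      using that by (simp add: P_def ipf_add_l)
    then show "\<psi> + \<psi>' \<in> Lam3_delta br" if "\<psi> \<in> Lam3_delta br" "\<psi>' \<in> Lam3_delta br" for \<psi> \<psi>'
      using that L fvs.subspace_add[OF subspace_Lam] by meson
    have "P (fscale c \<psi>) (fscale c \<phi>)" if "P \<psi> \<phi>" for \<psi> \<phi> c
      using that by (simp add: P_def ipf_scale_l)
    then show "fscale c \<psi> \<in> Lam3_delta br" if "\<psi> \<in> Lam3_delta br" for c \<psi>
      using that L fvs.subspace_scale[OF subspace_Lam] by meson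
  qed
  moreover have "gact br X \<psi> \<in> Lam3_delta br" if \<psi>: "\<psi> \<in> Lam3_delta br" for X \<psi>
  proof -
    obtain \<phi> where \<phi>: "\<phi> \<in> Lam 4" "P \<psi> \<phi>" and \<psi>: "\<psi> \<in> Lam 3" using \<psi> L by blast
    have "P (gact br X \<psi>) (gact br X \<phi>)"
      unfolding P_def
    proof
      fix \<xi> :: "'g form" assume \<xi>: "\<xi> \<in> Lam 3"
      have "ipf br 3 (gact br X \<psi>) \<xi> = - ipf br 3 \<psi> (gact br X \<xi>)"
        using \<psi> \<xi> by (intro ipf_gact Lam_multilinear)
      also have "\<dots> = - ipf br 4 \<phi> (gact br X (dform br \<xi>))"
        using \<phi>(2) Lam_gact[OF \<xi>] dform_gact[OF \<xi>] by (simp add: P_def)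
      also have "\<dots> = ipf br 4 (gact br X \<phi>) (dform br \<xi>)"
        using ipf_gact[OF Lam_multilinear[OF \<phi>(1)] dform_Lam_3_multilinear[OF \<xi>]] by simp
      finally show "ipf br 3 (gact br X \<psi>) \<xi> = ipf br 4 (gact br X \<phi>) (dform br \<xi>)" .
    qed
    then show ?thesis using L Lam_gact \<phi>(1) \<psi> by blast
  qed
  ultimately show ?thesis by (auto simp: submodule_iff)
qed

text \<open>Orthogonal projection of \<open>\<Lambda>\<^sup>3\<close> to \<open>g \<otimes> g\<^sup>\<bottom>\<close>.\<close>
definition proj_form :: "'g form \<Rightarrow> 'g form" where
  "proj_form \<psi> = (\<lambda>xs. \<psi> xs - (case xs of [x, y, z] \<Rightarrow> kip br (contraction (interior x \<psi>)) (br y z) | _ \<Rightarrow> 0))"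

lemma proj_form_3: "proj_form \<psi> [x, y, z] = \<psi> [x, y, z] - kip br (contraction (interior x \<psi>)) (br y z)"
  by (simp add: proj_form_def)

lemma contraction_interior_linear:
  assumes m: "multilinear_form 3 \<psi>" shows "linear (\<lambda>x. contraction (interior x \<psi>))"
  by (simp add: linear_iff contraction_def interior_apply multilinear_3_simps[OF m] scaleR_add_left
      sum.distrib scaleR_sum_right)

lemma multilinear_proj_form:
  assumes m: "multilinear_form 3 \<psi>" shows "multilinear_form 3 (proj_form \<psi>)"
proof (rule multilinear_form_3I)
  fix xs :: "'g list" assume "length xs \<noteq> 3"
  then show "proj_form \<psi> xs = 0"
    using multilinear_length[OF m] by (auto simp: proj_form_def split: list.split)
next
  note c = linear_add[OF contraction_interior_linear[OF m]] linear_scale[OF contraction_interior_linear[OF m]]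
  show "linear (\<lambda>x. proj_form \<psi> [x, y, z])" "linear (\<lambda>y. proj_form \<psi> [x, y, z])"
    "linear (\<lambda>z. proj_form \<psi> [x, y, z])" for x y z
    by (simp_all add: proj_form_3 linear_iff multilinear_3_simps[OF m] c algebra_simps)
qed

text \<open>By \<open>contract_d\<close> the subtracted term has the same contraction as the slice
  it corrects.\<close>

lemma proj_form_TT:
  assumes \<psi>: "\<psi> \<in> Lam 3" shows "proj_form \<psi> \<in> TT br"
proof (rule TT_I)
  note m = Lam_multilinear[OF \<psi>]
  show "multilinear_form 3 (proj_form \<psi>)" by (rule multilinear_proj_form[OF m])
  show "proj_form \<psi> [x, y, y] = 0" for x y by (simp add: proj_form_3 Lam_3_zero[OF \<psi>])
  fix x
  have "contraction (interior x (proj_form \<psi>)) = contraction (interior x \<psi>)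
      - (\<Sum>a\<in>onb br. \<Sum>b\<in>onb br. kip br (contraction (interior x \<psi>)) (br a b) *\<^sub>R br a b)"
    by (simp add: contraction_def[of "interior x (proj_form \<psi>)"] contraction_def[of "interior x \<psi>"]
      interior_apply proj_form_3 scaleR_diff_left sum_subtractf)
  then show "contraction (interior x (proj_form \<psi>)) = 0" by (simp add: contract_d)
qed

lemma proj_form_hom: "module_hom_on br (Collect (multilinear_form 3)) proj_form"
  unfolding module_hom_on_def
proof (intro conjI ballI allI)
  show "proj_form (\<phi> + \<psi>) = proj_form \<phi> + proj_form \<psi>" for \<phi> \<psi>
    by (auto simp: proj_form_def fun_eq_iff fapply interior_add contraction_add split: list.split)
  show "proj_form (fscale c \<phi>) = fscale c (proj_form \<phi>)" for c \<phi>
    by (auto simp: proj_form_def fun_eq_iff fapply interior_scale contraction_scale algebra_simps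
        split: list.split)
  fix X and \<psi> :: "'g form" assume "\<psi> \<in> Collect (multilinear_form 3)"
  then have m: "multilinear_form 3 \<psi>" by simp
  show "proj_form (gact br X \<psi>) = gact br X (proj_form \<psi>)"
  proof (rule form_eqI)
    show "multilinear_form 3 (proj_form (gact br X \<psi>))" by (intro multilinear_proj_form multilinear_gact m)
    show "multilinear_form 3 (gact br X (proj_form \<psi>))" by (intro multilinear_proj_form multilinear_gact m)
    fix xs :: "'g list" assume "length xs = 3"
    then obtain x y z where xs: "xs = [x, y, z]" by (rule length3E)
    have c: "contraction (interior x (gact br X \<psi>)) =
        br X (contraction (interior x \<psi>)) - contraction (interior (br X x) \<psi>)"
      by (simp add: interior_gact contraction_diff contraction_gact[OF multilinear_interior[OF m]])
    show "proj_form (gact br X \<psi>) xs = gact br X (proj_form \<psi>) xs"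
      unfolding xs gact_3 proj_form_3 c by (simp add: kip_inv br_der[of X])
  qed
qed

text \<open>The correction to each slice is an exact 2-form, on which the cyclic sum vanishes by
  Jacobi. Both operators therefore take the same value on a 3-form and on its projection.\<close>

lemma cyc_proj_form: "cyc (proj_form \<psi>) w x y z = cyc \<psi> w x y z"
proof -
  have "kip br c (br x (br y z)) + kip br c (br y (br z x)) + kip br c (br z (br x y)) = 0" for c
    using jacobi[of x y z] kip.Q_simps(2)[symmetric] by (simp flip: kip.Q_simps(2))
  from this[of "contraction (interior w \<psi>)"] show ?thesis
    unfolding cyc_def proj_form_3 by linarith
qed

lemma D_plus_proj_form:
  assumes \<psi>: "\<psi> \<in> Lam 3" shows "D_plus br (proj_form \<psi>) = fscale 2 (dform br \<psi>)"
proof -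
  note m = Lam_multilinear[OF \<psi>]
  have "D_plus br (proj_form \<psi>) = D_plus br \<psi>"
  proof (rule form_eqI)
    show "multilinear_form 4 (D_plus br (proj_form \<psi>))" "multilinear_form 4 (D_plus br \<psi>)"
      by (intro Lam_multilinear D_plus_Lam multilinear_proj_form m)+
    fix xs :: "'g list" assume "length xs = 4"
    then show "D_plus br (proj_form \<psi>) xs = D_plus br \<psi> xs"
      by (elim length4E) (simp add: D_plus_4[OF m] D_plus_4[OF multilinear_proj_form[OF m]] cyc_proj_form)
  qed
  then show ?thesis by (simp add: D_plus_Lam_3[OF \<psi>])
qed

text \<open>Since \<tau> is \<open>y \<and> z\<close>, this computes a component of the
  codifferential of \<psi> up to normalisation. The three terms of \<open>dform br \<tau>\<close>
  contribute equally, whence the factor 3.\<close>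

lemma ipf_dform_decomposable:
  fixes y z
  assumes \<psi>: "\<psi> \<in> Lam 3"
  defines "\<tau> \<equiv> (\<lambda>xs. case xs of [p, q] \<Rightarrow> kip br y p * kip br z q - kip br y q * kip br z p | _ \<Rightarrow> 0)"
  shows "\<tau> \<in> Lam 2"
    and "ipf br 3 \<psi> (dform br \<tau>) =
      3 * (\<Sum>a\<in>onb br. \<psi> [z, a, br y a]) - 3 * (\<Sum>a\<in>onb br. \<psi> [y, a, br z a])"
proof -
  note m = Lam_multilinear[OF \<psi>]
  have \<tau>2: "\<tau> [p, q] = kip br y p * kip br z q - kip br y q * kip br z p" for p q
    by (simp add: \<tau>_def)
  show "\<tau> \<in> Lam 2"
    unfolding Lam_2_iff
  proof (intro conjI allI)
    show "multilinear_form 2 \<tau>"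
      by (rule multilinear_form_2I)
        (auto simp: \<tau>_def linear_iff algebra_simps split: list.split)
  qed (simp add: \<tau>2)
  let ?S = "\<lambda>f. \<Sum>p\<in>onb br. \<Sum>q\<in>onb br. \<Sum>r\<in>onb br. f p q r :: real"
  define K where "K u v = (\<Sum>p\<in>onb br. \<Sum>q\<in>onb br. \<psi> [u, p, q] * kip br v (br p q))" for u v
  have K: "K u v = (\<Sum>a\<in>onb br. \<psi> [u, a, br v a])" for u v
  proof -
    have "(\<Sum>q\<in>onb br. \<psi> [u, p, q] * kip br v (br p q)) = \<psi> [u, p, br v p]" for p
    proof -
      have "kip br v (br p q) = kip br (br v p) q" for q
        using kip_inv[of p v q] br_skew[of p v] by simp
      then show ?thesis using linear_expand'(2)[OF multilinear_3_linear(3)[OF m]] by simp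
    qed
    then show ?thesis by (simp add: K_def)
  qed
  have last: "(\<Sum>r\<in>onb br. \<psi> [p, q, r] * \<tau> [u, r]) = \<psi> [p, q, z] * kip br y u - \<psi> [p, q, y] * kip br z u"
    for p q u
  proof -
    have "(\<Sum>r\<in>onb br. \<psi> [p, q, r] * \<tau> [u, r]) =
       (\<Sum>r\<in>onb br. \<psi> [p, q, r] * kip br z r) * kip br y u - (\<Sum>r\<in>onb br. \<psi> [p, q, r] * kip br y r) * kip br z u"
      by (simp add: \<tau>2 algebra_simps sum_subtractf sum_distrib_left sum_distrib_right)
    then show ?thesis by (simp add: linear_expand'(2)[OF multilinear_3_linear(3)[OF m]])
  qed
  have rot: "\<psi> [p, q, r] = \<psi> [r, p, q]" for p q r
    using Lam_3_skew(2)[OF \<psi>, of p r q] Lam_3_skew(1)[OF \<psi>, of r p q] by simp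
  have A: "?S (\<lambda>p q r. \<psi> [p, q, r] * \<tau> [br p q, r]) = K z y - K y z"
    by (simp add: last K_def sum_subtractf rot[of _ _ z] rot[of _ _ y])
  \<comment> \<open>Renaming summation indices reduces the two other sums to \<open>A\<close>: a
    transposition of the arguments of \<psi> costs a sign, a rotation does not.\<close>
  have B: "?S (\<lambda>p q r. \<psi> [p, q, r] * \<tau> [br p r, q]) = - (K z y - K y z)"
  proof -
    have "?S (\<lambda>p q r. \<psi> [p, q, r] * \<tau> [br p r, q]) = ?S (\<lambda>p r q. \<psi> [p, q, r] * \<tau> [br p r, q])"
      by (intro sum.cong refl sum.swap)
    also have "\<dots> = - ?S (\<lambda>p r q. \<psi> [p, r, q] * \<tau> [br p r, q])"
      unfolding sum_negf[symmetric]
      by (intro sum.cong refl) (subst Lam_3_skew(2)[OF \<psi>], simp)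
    finally show ?thesis unfolding A .
  qed
  have C: "?S (\<lambda>p q r. \<psi> [p, q, r] * \<tau> [br q r, p]) = K z y - K y z"
  proof -
    have "?S (\<lambda>p q r. \<psi> [p, q, r] * \<tau> [br q r, p]) = ?S (\<lambda>q p r. \<psi> [p, q, r] * \<tau> [br q r, p])"
      by (rule sum.swap)
    also have "\<dots> = ?S (\<lambda>q r p. \<psi> [p, q, r] * \<tau> [br q r, p])"
      by (intro sum.cong refl sum.swap)
    also have "\<dots> = ?S (\<lambda>q r p. \<psi> [q, r, p] * \<tau> [br q r, p])"
      by (intro sum.cong refl arg_cong2[of _ _ _ _ "(*)"] rot[symmetric])
    finally show ?thesis unfolding A .
  qed
  have "ipf br 3 \<psi> (dform br \<tau>) = ?S (\<lambda>p q r. \<psi> [p, q, r] * \<tau> [br p q, r])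
      - ?S (\<lambda>p q r. \<psi> [p, q, r] * \<tau> [br p r, q]) + ?S (\<lambda>p q r. \<psi> [p, q, r] * \<tau> [br q r, p])"
    by (simp add: ipf_3 dform_2 algebra_simps sum.distrib sum_subtractf)
  then show "ipf br 3 \<psi> (dform br \<tau>) =
      3 * (\<Sum>a\<in>onb br. \<psi> [z, a, br y a]) - 3 * (\<Sum>a\<in>onb br. \<psi> [y, a, br z a])"
    unfolding A B C by (simp add: K)
qed

text \<open>The components of \<open>D_minus\<close> are those from
  \<open>ipf_dform_decomposable\<close>. They vanish because \<psi> is a codifferential and its
  pairing with \<open>dform br \<tau>\<close> involves the differential applied twice.\<close>

lemma D_minus_proj_form:
  assumes "\<psi> \<in> Lam3_delta br" shows "D_minus br (proj_form \<psi>) = 0"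
proof (rule form_eqI)
  obtain \<phi> where \<psi>: "\<psi> \<in> Lam 3" and \<phi>: "\<forall>\<xi>\<in>Lam 3. ipf br 3 \<psi> \<xi> = ipf br 4 \<phi> (dform br \<xi>)"
    using assms by (auto simp: Lam3_delta_def)
  note m = Lam_multilinear[OF \<psi>]
  show "multilinear_form 2 (D_minus br (proj_form \<psi>))"
    by (intro Lam_multilinear D_minus_Lam multilinear_proj_form m)
  show "multilinear_form 2 0" using fvs.subspace_0[OF subspace_multilinear] by blast
  fix xs :: "'g list" assume "length xs = 2"
  then obtain y z where xs: "xs = [y, z]" by (rule length2E)
  note \<tau> = ipf_dform_decomposable[OF \<psi>, of y z]
  define \<tau> where "\<tau> = (\<lambda>xs. case xs of [p, q] \<Rightarrow> kip br y p * kip br z q - kip br y q * kip br z p | _ \<Rightarrow> 0)"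
  have \<tau>L: "\<tau> \<in> Lam 2" unfolding \<tau>_def by (rule \<tau>(1))
  have "ipf br 4 \<phi> (dform br (dform br \<tau>)) = 0"
    unfolding ipf_def
  proof (intro sum.neutral ballI)
    fix ys assume "ys \<in> tuples 4"
    then have "length ys = 4" by simp
    then show "\<phi> ys * dform br (dform br \<tau>) ys = 0"
      by (elim length4E) (simp add: dform_dform[OF \<tau>L])
  qed
  then have "ipf br 3 \<psi> (dform br \<tau>) = 0" using \<phi> dform_Lam_2[OF \<tau>L] by simp
  then have e: "(\<Sum>a\<in>onb br. \<psi> [z, a, br y a]) = (\<Sum>a\<in>onb br. \<psi> [y, a, br z a])"
    using \<tau>(2) by (simp add: \<tau>_def)
  have "cyc \<psi> a a y z = \<psi> [z, a, br y a] - \<psi> [y, a, br z a]" for a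
    using Lam_3_skew(1)[OF \<psi>, of y a "br z a"] Lam_3_skew(1)[OF \<psi>, of z a "br y a"]
    by (simp add: cyc_def Lam_3_zero[OF \<psi>] br_skew[of a y] multilinear_3_simps[OF m])
  then show "D_minus br (proj_form \<psi>) xs = 0 xs"
    by (simp add: xs D_minus_2[OF multilinear_proj_form[OF m]] cyc_proj_form sum_subtractf e zero_fun_apply)
qed

lemma W_har_perp_D_minus:
  "\<exists>U. submodule br (W_har_perp br (D_minus br)) U \<and> module_iso br U (Lam3_delta br)"
proof (rule W_har_perp_lift[OF _ Lam3_delta_submodule])
  have L3: "\<psi> \<in> Lam 3" if "\<psi> \<in> Lam3_delta br" for \<psi> using that by (simp add: Lam3_delta_def)
  show "module_hom_on br (Lam3_delta br) proj_form"
    using L3 Lam_multilinear by (intro module_hom_on_subset[OF proj_form_hom]) blast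
  show "proj_form s \<in> TT br" if "s \<in> Lam3_delta br" for s by (intro proj_form_TT L3 that)
  show "D_minus br (proj_form s) = 0" if "s \<in> Lam3_delta br" for s by (rule D_minus_proj_form[OF that])
  show "\<psi> = 0" if \<psi>: "\<psi> \<in> Lam3_delta br" and 0: "D_plus br (proj_form \<psi>) = 0" for \<psi>
  proof -
    have "fscale 2 (dform br \<psi>) = 0" using D_plus_proj_form[OF L3[OF \<psi>]] 0 by simp
    then have d0: "dform br \<psi> = 0" by (simp add: fun_eq_iff fapply)
    obtain \<phi> where "\<forall>\<xi>\<in>Lam 3. ipf br 3 \<psi> \<xi> = ipf br 4 \<phi> (dform br \<xi>)"
      using \<psi> by (auto simp: Lam3_delta_def)
    \<comment> \<open>A form that is both closed and coexact is orthogonal to itself.\<close>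
    then have "ipf br 3 \<psi> \<psi> = 0" using L3[OF \<psi>] d0 by (simp add: ipf_zero_r)
    then show ?thesis using ipf_definite[OF Lam_multilinear[OF L3[OF \<psi>]]] by simp
  qed
qed auto

text \<open>The tensor \<open>\<Sum> e\<^sub>a \<otimes> pr(v \<and> e\<^sub>a)\<close>, where \<open>pr\<close> is the orthogonal projection to \<open>g\<^sup>\<bottom>\<close>;
  the last summand is the part of \<open>v \<and> x\<close> removed by \<open>pr\<close>.\<close>
definition wedge_tensor :: "'g \<Rightarrow> 'g form" where
  "wedge_tensor v = (\<lambda>xs. case xs of [x, y, z] \<Rightarrow>
     kip br v y * kip br x z - kip br v z * kip br x y - 2 * kip br (br v x) (br y z) | _ \<Rightarrow> 0)"

lemma wedge_tensor_3: "wedge_tensor v [x, y, z] =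
    kip br v y * kip br x z - kip br v z * kip br x y - 2 * kip br (br v x) (br y z)"
  by (simp add: wedge_tensor_def)

lemma wedge_tensor_TT: "wedge_tensor v \<in> TT br"
proof (rule TT_I)
  show "multilinear_form 3 (wedge_tensor v)"
    by (rule multilinear_form_3I)
      (auto simp: wedge_tensor_def linear_iff algebra_simps split: list.split)
  show "wedge_tensor v [x, y, y] = 0" for x y by (simp add: wedge_tensor_3)
  fix x
  \<comment> \<open>Each of the two decomposable terms contributes \<open>br v x\<close>, which the
    factor 2 in the exact term of \<open>wedge_tensor\<close> balances.\<close>
  have 1: "(\<Sum>a\<in>onb br. \<Sum>b\<in>onb br. (kip br p a * kip br q b) *\<^sub>R br a b) = br p q" for p q
  proof -
    have "(\<Sum>b\<in>onb br. (kip br p a * kip br q b) *\<^sub>R br a b) = kip br p a *\<^sub>R br a q" for a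
      using linear_expand[OF br_lin_r, of q a] by (simp flip: scaleR_scaleR scaleR_sum_right)
    then show ?thesis using linear_expand[OF br_lin_l, of p q] by simp
  qed
  have "contraction (interior x (wedge_tensor v)) =
      (\<Sum>a\<in>onb br. \<Sum>b\<in>onb br. (kip br v a * kip br x b) *\<^sub>R br a b)
      - (\<Sum>a\<in>onb br. \<Sum>b\<in>onb br. (kip br x a * kip br v b) *\<^sub>R br a b)
      - 2 *\<^sub>R (\<Sum>a\<in>onb br. \<Sum>b\<in>onb br. kip br (br v x) (br a b) *\<^sub>R br a b)"
    by (simp add: contraction_def interior_apply wedge_tensor_3 scaleR_diff_left sum_subtractf
        scaleR_sum_right mult.commute)
  also have "\<dots> = 0" by (simp add: 1 contract_d br_skew[of x v] scaleR_2)
  finally show "contraction (interior x (wedge_tensor v)) = 0" .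
qed

text \<open>The last summand of \<open>wedge_tensor\<close> is exact in \<open>y\<close>,
  \<open>z\<close> and drops out by Jacobi.\<close>

lemma cyc_wedge_tensor:
  "cyc (wedge_tensor v) w x y z = kip br v x * kip br w (br y z) + kip br v y * kip br w (br z x)
     + kip br v z * kip br w (br x y)
     - kip br w x * kip br v (br y z) - kip br w y * kip br v (br z x) - kip br w z * kip br v (br x y)"
proof -
  have "kip br c (br x (br y z)) + kip br c (br y (br z x)) + kip br c (br z (br x y)) = 0" for c
    using jacobi[of x y z] by (simp flip: kip.Q_simps(2))
  from this[of "br v w"] show ?thesis
    unfolding cyc_def wedge_tensor_3 by (simp add: algebra_simps)
qed

lemma omega_wedge_in_image: "wedge_r (omega br) (flat br v) \<in> D_plus br ` TT br"
proof -
  \<comment> \<open>Each product of \<open>v\<close> with \<open>omega\<close> arises from three of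
    the four terms of \<open>D_plus_4\<close>, while the terms containing \<open>kip br w x\<close>
    and its analogues cancel by symmetry. So \<open>D_plus\<close> sends
    \<open>wedge_tensor v\<close> to -3 times the wanted form.\<close>
  define T where "T = fscale (- 1/3) (wedge_tensor v)"
  note m = TT_multilinear[OF wedge_tensor_TT]
  have T: "T \<in> TT br"
    unfolding T_def using TT_submodule by (intro fvs.subspace_scale wedge_tensor_TT) (simp add: submodule_iff)
  have "wedge_r (omega br) (flat br v) xs = D_plus br T xs" for xs
  proof (cases "length xs = 4")
    case True
    then obtain w x y z where xs: "xs = [w, x, y, z]" by (rule length4E)
    have r1: "kip br b (br a c) = - kip br a (br b c)" for b a c
      using kip_cyclic[of b a c] kip_cyclic[of c b a] br_skew[of b c] by simp
    have r2: "kip br c (br a b) = kip br a (br b c)" for c a b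
      using kip_cyclic[of c a b] by simp
    note k = br_skew[of x w] br_skew[of y w] br_skew[of z w] br_skew[of y x] br_skew[of z x] br_skew[of z y]
      r1[of x w y] r1[of x w z] r1[of y w z] r1[of y x z] r2[of y w x] r2[of z w x] r2[of z w y] r2[of z x y]
      kip.sym[of x w] kip.sym[of y w] kip.sym[of z w] kip.sym[of y x] kip.sym[of z x] kip.sym[of z y]
    have om: "omega br [p, q, r] = - kip br p (br q r)" for p q r
      by (simp add: omega_def kip_def)
    show ?thesis
      unfolding xs T_def D_plus_scale[OF m] fscale_apply D_plus_4[OF m] cyc_wedge_tensor
      by (simp add: wedge_r_def flat_def del_nth_def om numeral_eq_Suc k algebra_simps)
  next
    case False
    then have "omega br (del_nth i xs) = 0" if "i < length xs" for i
      using that by (intro omega_length) (auto simp: del_nth_def)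
    then show ?thesis using False by (simp add: wedge_r_def D_plus_length)
  qed
  then show ?thesis using T by (metis ext imageI)
qed

text \<open>The trace of the inner product produces the dimension. Of the five other traced terms in
  \<open>cyc_wedge_tensor\<close>, two vanish and three contribute one each.\<close>

lemma D_minus_wedge_tensor:
  "D_minus br (wedge_tensor v) [y, z] = - (real DIM('g) - 3) * kip br v (br y z)"
proof -
  note m = TT_multilinear[OF wedge_tensor_TT]
  have n: "(\<Sum>a\<in>onb br. kip br a a) = real DIM('g)"
    using onb by (simp add: orthonormal_for_def)
  show ?thesis
  proof -
    have z: "kip br a (br z a) = 0" "kip br a (br a y) = 0" for a
      using kip_inv[of z a a] kip.sym[of "br z a" a] kip_inv[of a a y] by auto
    have lin: "linear (\<lambda>a. kip br a u)" "linear (\<lambda>a. kip br v (br u a))" "linear (\<lambda>a. kip br v (br a u))" for u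
      by (simp_all add: linear_iff)
    show ?thesis
      unfolding D_minus_2[OF m] cyc_wedge_tensor z
      by (simp add: sum.distrib sum_subtractf linear_expand'[OF lin(1)] linear_expand'[OF lin(2)]
          linear_expand'[OF lin(3)] n br_skew[of z y] algebra_simps flip: sum_distrib_right)
  qed
qed

section \<open>Surjectivity of \<open>D_minus\<close>\<close>

lemma D_minus_surj:
  assumes dim: "DIM('g) \<noteq> 3" and \<phi>: "\<phi> \<in> Lam 2"
  shows "\<exists>T\<in>TT br. D_minus br T = \<phi>"
proof -
  have TTs: "fvs.subspace (TT br)" using TT_submodule by (simp add: submodule_iff)
  define I where "I = D_minus br ` TT br"
  have Is: "fvs.subspace I"
    using submodule_image[OF TT_submodule TT_hom(2)] by (simp add: I_def submodule_iff)
  have IL: "I \<subseteq> Lam 2" using D_minus_Lam TT_multilinear by (auto simp: I_def)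
  then have Im: "multilinear_form 2 \<psi>" if "\<psi> \<in> I" for \<psi> using that Lam_multilinear by blast
  obtain \<psi> where \<psi>: "\<psi> \<in> I" "\<And>u. u \<in> I \<Longrightarrow> ipf br 2 (\<phi> - \<psi>) u = 0"
    using projection[OF Is Im] by blast
  define \<theta> where "\<theta> = \<phi> - \<psi>"
  have \<theta>L: "\<theta> \<in> Lam 2" unfolding \<theta>_def using \<phi> \<psi>(1) IL by (intro fvs.subspace_diff[OF subspace_Lam]) auto
  \<comment> \<open>Testing \<theta> against the image of \<open>wedge_tensor v\<close> yields its
    pairing with the exact 2-form of \<open>v\<close>, up to a coefficient that is nonzero because
    the dimension is not 3.\<close>
  have "kip br v (contraction \<theta>) = 0" for v
  proof -
    have "ipf br 2 \<theta> (D_minus br (wedge_tensor v)) = 0"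
      using \<psi>(2) wedge_tensor_TT by (simp add: \<theta>_def I_def)
    moreover have "ipf br 2 \<theta> (D_minus br (wedge_tensor v)) =
        - (real DIM('g) - 3) * (\<Sum>a\<in>onb br. \<Sum>b\<in>onb br. \<theta> [a, b] * kip br v (br a b))"
      unfolding ipf_2 D_minus_wedge_tensor by (simp only: sum_distrib_left mult.left_commute)
    moreover have "kip br v (contraction \<theta>) = (\<Sum>a\<in>onb br. \<Sum>b\<in>onb br. \<theta> [a, b] * kip br v (br a b))"
      by (simp add: contraction_def kip.Q_simps(8))
    ultimately show ?thesis using dim by simp
  qed
  then have "contraction \<theta> = 0" using kip.pos by force
  then have \<theta>p: "\<theta> \<in> gperp br" using \<theta>L by (simp add: gperp_iff)
  \<comment> \<open>Now that \<theta> lies in \<open>gperp br\<close>,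
    \<open>act_form \<theta>\<close> is an element of \<open>TT br\<close>, so
    \<open>casimir_form \<theta>\<close> belongs to the image.\<close>
  have "ipf br 2 \<theta> (casimir_form \<theta>) = 0"
    using \<psi>(2) act_form_TT[OF \<theta>p] D_minus_act_form[OF \<theta>p] by (force simp: \<theta>_def I_def)
  then have "\<theta> = 0" using casimir_form_definite[OF \<theta>L] ipf_sym by metis
  then have "\<phi> = \<psi>" by (simp add: \<theta>_def)
  then show ?thesis using \<psi>(1) by (auto simp: I_def)
qed

end

theorem theorem4p8:
  fixes br :: "'g::euclidean_space \<Rightarrow> 'g \<Rightarrow> 'g"
  assumes "compact_lie_algebra br" and "simple_lie_algebra br" and "DIM('g) \<ge> 8"
  shows
    "(\<exists>(m::nat) (V :: nat \<Rightarrow> 'g form set).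
        (\<forall>i<m. V i \<subseteq> TT br \<and> irreducible_module br (V i) \<and>
           (\<exists>U. U \<subseteq> Lam2_plus_Lam4 \<and> irreducible_module br U \<and> module_iso br (V i) U)) \<and>
        (\<forall>T\<in>TT br. \<exists>w\<in>W_har br. \<exists>v. (\<forall>i<m. v i \<in> V i) \<and>
           T = (\<lambda>xs. w xs + (\<Sum>i<m. v i xs))) \<and>
        (\<forall>w\<in>W_har br. \<forall>v. (\<forall>i<m. v i \<in> V i) \<and> (\<lambda>xs. w xs + (\<Sum>i<m. v i xs)) = zero_form
           \<longrightarrow> w = zero_form \<and> (\<forall>i<m. v i = zero_form)))
   \<and> (\<exists>U. submodule br (W_har_perp br (D_plus br)) U \<and> module_iso br U (gperp br))
   \<and> (\<exists>U. submodule br (W_har_perp br (D_minus br)) U \<and> module_iso br U (Lam3_delta br))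
   \<and> (\<forall>v. wedge_r (omega br) (flat br v) \<in> D_plus br ` TT br)
   \<and> (\<forall>\<phi>\<in>Lam 2. \<exists>T\<in>TT br. D_minus br T = \<phi>)"
proof -
  interpret compact_simple br by unfold_locales (fact assms)+
  have "DIM('g) \<noteq> 3" using assms(3) by simp
  then show ?thesis
    by (intro conjI TT_decomposition W_har_perp_D_plus W_har_perp_D_minus)
      (use omega_wedge_in_image D_minus_surj in auto)
qed

end
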